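(* Let $\gamma>1$, $r_0>0$ and let $b_0>0$ be a constant. Let $\rho_0>0$, $U_{10}>0$, $U_{20}\in\mathbb{R}$, $A_0>0$, $E_0>0$ be constants with $\rho_0>b_0$ and $$U_{10}^2<\gamma A_0\rho_0^{\gamma-1}<U_{10}^2+U_{20}^2$$ (the incoming flow is supersonic, but subsonic in the $r$-direction). Then, if $r_1>r_0$ is large enough, there exists a unique smooth transonic flow $(\bar\rho_t(r),\bar U_{1t}(r),\bar U_{2t}(r),\bar A_t,\bar E_t(r))$ on $[r_0,r_1]$ solving $$\begin{cases}(r\bar\rho\,\bar U_1)'=0,\\ \bar U_1\bar U_1'+\frac{1}{\bar\rho}\bar P'-\frac1r\bar U_2^2=\bar E,\\ \bar U_1\bar U_2'+\frac1r\bar U_1\bar U_2=0,\\ \bar U_1\bar A'=0,\\ \bar E'+\frac1r\bar E=\bar\rho-b_0,\end{cases}\qquad \bar P=\bar A\,\bar\rho^{\gamma},$$ (with $'=\frac{d}{dr}$) with initial data $\bar\rho(r_0)=\rho_0$, $\bar U_1(r_0)=U_{10}$, $\bar U_2(r_0)=U_{20}$, $\bar A(r_0)=A_0$, $\bar E(r_0)=E_0$.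
   Context: The system is the steady Euler-Poisson system for cylindrically symmetric flows $\mathbf u=\bar U_1(r)\mathbf e_r+\bar U_2(r)\mathbf e_\theta$ with density $\bar\rho(r)$, entropy function $\bar A(r)$ and radial electric field $\bar E(r)$. The sound speed is $\bar c^2=\gamma\bar A\bar\rho^{\gamma-1}$, and $|\bar{\mathbf M}|^2=(\bar U_1^2+\bar U_2^2)/\bar c^2$. The flow is supersonic (subsonic, sonic) at $r$ if $|\bar{\mathbf M}(r)|^2>1$ ($<1$, $=1$). A smooth transonic flow on $[r_0,r_1]$ is a smooth solution that is supersonic at some points and subsonic at other points of $[r_0,r_1]$.
   Formalization: For 1<γ<2 every such solution blows up at a finite radius, so "r1 large enough" is taken as: r1 above a threshold and below the lifespan T of the solution; T is infinite for γ≥2, and for r1≥T no smooth solution on [r0,r1] exists. *)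

theory Defs
  imports "HOL-Analysis.Analysis"
begin

text \<open>
  Derivative along the closed interval \<open>[a, b]\<close>: two-sided in the interior, one-sided at the
  two end points.
\<close>

abbreviation ddr :: "real \<Rightarrow> real \<Rightarrow> (real \<Rightarrow> real) \<Rightarrow> real \<Rightarrow> real" where
  "ddr a b f r \<equiv> vector_derivative f (at r within {a..b})"

text \<open>
  \<open>C\<^sup>\<infinity>\<close> on a closed interval, up to and including the end points; \<open>D n\<close> is the \<open>n\<close>-th derivative.
\<close>

definition smooth_on_Icc :: "real \<Rightarrow> real \<Rightarrow> (real \<Rightarrow> real) \<Rightarrow> bool" where
  "smooth_on_Icc a b f \<longleftrightarrow>
     (\<exists>D :: nat \<Rightarrow> real \<Rightarrow> real. D 0 = f \<and>
        (\<forall>n. \<forall>x\<in>{a..b}. (D n has_real_derivative D (Suc n) x) (at x within {a..b})))"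

definition pressure :: "real \<Rightarrow> (real \<Rightarrow> real) \<Rightarrow> (real \<Rightarrow> real) \<Rightarrow> real \<Rightarrow> real" where
  "pressure \<gamma> \<rho> A r = A r * \<rho> r powr \<gamma>"

definition sound_speed_sq :: "real \<Rightarrow> (real \<Rightarrow> real) \<Rightarrow> (real \<Rightarrow> real) \<Rightarrow> real \<Rightarrow> real" where
  "sound_speed_sq \<gamma> \<rho> A r = \<gamma> * A r * \<rho> r powr (\<gamma> - 1)"

definition mach_sq ::
  "real \<Rightarrow> (real \<Rightarrow> real) \<Rightarrow> (real \<Rightarrow> real) \<Rightarrow> (real \<Rightarrow> real) \<Rightarrow> (real \<Rightarrow> real) \<Rightarrow> real \<Rightarrow> real" where
  "mach_sq \<gamma> \<rho> U1 U2 A r = ((U1 r)\<^sup>2 + (U2 r)\<^sup>2) / sound_speed_sq \<gamma> \<rho> A r"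

text \<open>
  Smooth solutions of the cylindrically symmetric steady Euler--Poisson system on \<open>[r0, r1]\<close>.
  Positivity of the density belongs to the notion of a flow: it gives \<open>1 / \<rho>\<close> and the real powers
  of \<open>\<rho>\<close> their usual meaning (Isabelle's \<open>powr\<close> and division are total).
\<close>

definition smooth_flow ::
  "real \<Rightarrow> real \<Rightarrow> real \<Rightarrow> real \<Rightarrow>
   (real \<Rightarrow> real) \<Rightarrow> (real \<Rightarrow> real) \<Rightarrow> (real \<Rightarrow> real) \<Rightarrow> (real \<Rightarrow> real) \<Rightarrow> (real \<Rightarrow> real) \<Rightarrow> bool" where
  "smooth_flow \<gamma> b0 r0 r1 \<rho> U1 U2 A E \<longleftrightarrow>
     smooth_on_Icc r0 r1 \<rho> \<and> smooth_on_Icc r0 r1 U1 \<and> smooth_on_Icc r0 r1 U2 \<and>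
     smooth_on_Icc r0 r1 A \<and> smooth_on_Icc r0 r1 E \<and>
     (\<forall>r\<in>{r0..r1}.
        \<rho> r > 0 \<and>
        ddr r0 r1 (\<lambda>s. s * \<rho> s * U1 s) r = 0 \<and>
        U1 r * ddr r0 r1 U1 r + 1 / \<rho> r * ddr r0 r1 (pressure \<gamma> \<rho> A) r - 1 / r * (U2 r)\<^sup>2 = E r \<and>
        U1 r * ddr r0 r1 U2 r + 1 / r * U1 r * U2 r = 0 \<and>
        U1 r * ddr r0 r1 A r = 0 \<and>
        ddr r0 r1 E r + 1 / r * E r = \<rho> r - b0)"

definition smooth_transonic_flow ::
  "real \<Rightarrow> real \<Rightarrow> real \<Rightarrow> real \<Rightarrow>
   (real \<Rightarrow> real) \<Rightarrow> (real \<Rightarrow> real) \<Rightarrow> (real \<Rightarrow> real) \<Rightarrow> (real \<Rightarrow> real) \<Rightarrow> (real \<Rightarrow> real) \<Rightarrow> bool" where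
  "smooth_transonic_flow \<gamma> b0 r0 r1 \<rho> U1 U2 A E \<longleftrightarrow>
     smooth_flow \<gamma> b0 r0 r1 \<rho> U1 U2 A E \<and>
     (\<exists>r\<in>{r0..r1}. mach_sq \<gamma> \<rho> U1 U2 A r > 1) \<and>
     (\<exists>r\<in>{r0..r1}. mach_sq \<gamma> \<rho> U1 U2 A r < 1)"

text \<open>
  Pitfall in reading ``\<open>r1\<close> large enough'': for \<open>1 < \<gamma> < 2\<close> the enthalpy grows like a solution of
  \<open>h'' = h powr (1 / (\<gamma> - 1))\<close>, with superlinear right-hand side, so the solution of the initial value
  problem blows up at a finite radius. Hence \<open>r1\<close> must range between the threshold for transonic
  flow and the end \<open>T\<close> of the lifespan, where \<open>T = \<infinity>\<close> if \<open>\<gamma> \<ge> 2\<close>.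
\<close>

end

(*
  The equations for U2, A and the mass flux integrate explicitly, which leaves a planar system for
  (rho, w) with w = r * E, regular as long as c^2 > U1^2. Since E0 > 0 and rho0 > b0, both components
  increase, and c^2 - U1^2 stays bounded away from 0; hence the solution continues until the density
  blows up. Along it c^2 does not decrease while U1^2 + U2^2 is O(1/r^2): either the flow lives long
  enough for the speed to drop below the initial sound speed, or the density, and with it c, exceeds
  any bound earlier. In both cases the flow becomes subsonic. Smoothness holds because all unknowns
  lie in a function algebra that is closed under differentiation.
*)
theory Submission
  imports Defs
begin

text \<open>With mass flux and entropy constant, the momentum equation reads
  \<open>(c^2 - U1^2) * rho' / rho = E + (U1^2 + U2^2) / r\<close>. It degenerates where the radial
  Mach number is 1, not where the total one is; because of the swirl the two loci differ, and the
  sonic radius is a regular point of the differential equation. The variable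
  \<open>w = r * E\<close> turns the Poisson equation into \<open>w' = r * (rho - b0)\<close>, whose
  right side keeps its sign as long as the density stays above \<open>b0\<close>. The field itself,
  damped by \<open>E / r\<close>, need not increase. Uniqueness must cover every smooth flow with
  the given data, and for such a flow the sign of \<open>c^2 - U1^2\<close> is not known in advance.
  It is recovered by showing that the quadrant above the initial values of density and
  \<open>w\<close> is never left. No maximal solution is glued together: solutions live on compact
  intervals, uniqueness makes them agree, and the lifespan is the supremum of the radii that are
  reached.\<close>

section \<open>Calculus on a closed interval with one-sided derivatives at the ends\<close>

lemma has_real_derivative_transform:
  fixes f g :: "real \<Rightarrow> real"
  assumes "x \<in> S" "\<And>y. y \<in> S \<Longrightarrow> g y = f y" "(f has_real_derivative D) (at x within S)"
  shows "(g has_real_derivative D) (at x within S)"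
  using has_vector_derivative_transform[of x S g f D] assms
  by (simp add: has_real_derivative_iff_has_vector_derivative)

lemma ddr_eqI:
  assumes "a < b" "x \<in> {a..b}" "(f has_real_derivative D) (at x within {a..b})"
  shows "ddr a b f x = D"
  using vector_derivative_within_closed_interval[OF assms(1,2)] assms(3)
  by (simp add: has_real_derivative_iff_has_vector_derivative)

lemma mono_on_of_nonneg_derivative_within:
  fixes f f' :: "real \<Rightarrow> real"
  assumes d: "\<And>x. x \<in> {a..b} \<Longrightarrow> (f has_real_derivative f' x) (at x within {a..b})"
    and nn: "\<And>x. x \<in> {a..b} \<Longrightarrow> f' x \<ge> 0"
  shows "mono_on {a..b} f"
proof (rule mono_onI)
  fix x y assume xy: "x \<in> {a..b}" "y \<in> {a..b}" "x \<le> y"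
  show "f x \<le> f y"
  proof (rule DERIV_nonneg_imp_increasing_open[OF xy(3)])
    fix z assume "x < z" "z < y"
    then have "z \<in> {a..b}" "at z within {a..b} = at z"
      using xy by (auto intro: at_within_Icc_at)
    then show "\<exists>D. DERIV f z :> D \<and> D \<ge> 0"
      using d nn by metis
  next
    have "continuous_on {a..b} f"
      using d by (intro DERIV_continuous_on) auto
    then show "continuous_on {x..y} f"
      by (rule continuous_on_subset) (use xy in auto)
  qed
qed

lemma constant_of_zero_derivative_within:
  fixes f :: "real \<Rightarrow> real"
  assumes d: "\<And>x. x \<in> {a..b} \<Longrightarrow> (f has_real_derivative 0) (at x within {a..b})"
    and x: "x \<in> {a..b}"
  shows "f x = f a"
proof -
  have "mono_on {a..b} f"
    by (rule mono_on_of_nonneg_derivative_within[where f' = "\<lambda>_. 0"]) (use d in auto)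
  moreover have "mono_on {a..b} (\<lambda>x. - f x)"
    by (rule mono_on_of_nonneg_derivative_within[where f' = "\<lambda>_. 0"])
      (use d in \<open>auto intro!: derivative_eq_intros\<close>)
  ultimately show ?thesis
    using x by (auto simp: monotone_on_def intro!: antisym)
qed

lemma gronwall_exp:
  fixes u u' :: "real \<Rightarrow> real"
  assumes d: "\<And>x. x \<in> {a..b} \<Longrightarrow> (u has_real_derivative u' x) (at x within {a..b})"
    and le: "\<And>x. x \<in> {a..b} \<Longrightarrow> u' x \<le> K * u x"
    and x: "x \<in> {a..b}"
  shows "u x \<le> u a * exp (K * (x - a))"
proof -
  have "mono_on {a..b} (\<lambda>x. - (u x * exp (- K * (x - a))))"
    by (rule mono_on_of_nonneg_derivative_within
          [where f' = "\<lambda>x. (K * u x - u' x) * exp (- K * (x - a))"])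
      (use le in \<open>auto intro!: derivative_eq_intros d simp: algebra_simps\<close>)
  then have "u x * exp (- K * (x - a)) \<le> u a"
    using mono_onD[of "{a..b}" _ a x] x by fastforce
  then show ?thesis
    by (simp add: exp_minus pos_divide_le_eq flip: divide_inverse)
qed

section \<open>Existence and uniqueness for Lipschitz vector fields\<close>

text \<open>Continuity is asked of the composition with continuous curves, which is what makes the
  Picard integrand integrable; the truncated field of \<open>sol_until_density\<close> is verified
  in this form.\<close>

lemma picard_existence:
  fixes f :: "real \<Rightarrow> 'a::banach \<Rightarrow> 'a"
  assumes ab: "a \<le> b" and L: "L > 0"
    and cont: "\<And>x. continuous_on {a..b} x \<Longrightarrow> continuous_on {a..b} (\<lambda>t. f t (x t))"
    and lip: "\<And>t x y. t \<in> {a..b} \<Longrightarrow> norm (f t x - f t y) \<le> L * norm (x - y)"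
  shows "\<exists>x. x a = x0 \<and>
    (\<forall>t\<in>{a..b}. (x has_vector_derivative f t (x t)) (at t within {a..b}))"
proof -
  \<comment> \<open>The weight \<open>exp (- K * (t - a))\<close> makes the Picard map a contraction on all of \<open>[a, b]\<close>.\<close>
  define K where "K = 2 * L"
  have K: "K > 0" using L by (simp add: K_def)
  \<comment> \<open>Clamping the time extends functions on \<open>[a, b]\<close> to bounded
    continuous functions on the whole line, the complete space in which the fixed point is
    sought.\<close>
  define c where "c t = max a (min b t)" for t
  have c: "c t \<in> {a..b}" for t using ab by (auto simp: c_def)
  have c_id: "t \<in> {a..b} \<Longrightarrow> c t = t" for t by (auto simp: c_def)
  \<comment> \<open>\<open>y\<close> is the rescaled unknown and \<open>X y\<close> the curve
    itself, so the sup norm of \<open>y\<close> is the weighted norm of \<open>X y\<close>.\<close>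
  define X where "X y s = exp (K * (s - a)) *\<^sub>R apply_bcontfun y s" for y :: "real \<Rightarrow>\<^sub>C 'a" and s
  define Q where "Q y t = exp (- K * (t - a)) *\<^sub>R (x0 + integral {a..t} (\<lambda>s. f s (X y s)))"
    for y :: "real \<Rightarrow>\<^sub>C 'a" and t
  have contX: "continuous_on S (X y)" for y S
    unfolding X_def by (intro continuous_intros) auto
  have contf: "continuous_on {a..b} (\<lambda>s. f s (X y s))" for y
    by (intro cont contX)
  have int: "(\<lambda>s. f s (X y s)) integrable_on {a..t}" if "t \<in> {a..b}" for y t
    by (intro integrable_continuous_real continuous_on_subset[OF contf]) (use that in auto)
  have contQ: "continuous_on {a..b} (Q y)" for y
    unfolding Q_def using ab
    by (intro continuous_intros indefinite_integral_continuous_1 int) auto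
  have "(\<lambda>t. Q y (c t)) \<in> bcontfun" for y
  proof -
    have "continuous_on UNIV (\<lambda>t. Q y (c t))"
      by (rule continuous_on_compose2[OF contQ]) (use c in \<open>auto simp: c_def intro!: continuous_intros\<close>)
    moreover have "bounded (range (\<lambda>t. Q y (c t)))"
      by (rule bounded_subset[OF compact_imp_bounded[OF compact_continuous_image[OF contQ]]])
        (use c in auto)
    ultimately show ?thesis by (simp add: bcontfun_def)
  qed
  then have apply_P: "apply_bcontfun (Bcontfun (\<lambda>t. Q y (c t))) t = Q y (c t)" for y t
    by (simp add: Bcontfun_inverse)
  have contraction: "dist (Bcontfun (\<lambda>t. Q y (c t))) (Bcontfun (\<lambda>t. Q z (c t))) \<le> 1/2 * dist y z"
    for y z
  proof (rule dist_bound)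
    fix t0
    define t where "t = c t0"
    have t: "t \<in> {a..b}" using c by (simp add: t_def)
    \<comment> \<open>Since \<open>K = 2 * L\<close>, integrating the weight turns the Lipschitz
      constant \<open>L\<close> into the contraction factor \<open>1/2\<close>.\<close>
    have I: "((\<lambda>s. L * exp (K * (s - a)) * dist y z) has_integral
        (1/2 * exp (K * (t - a)) * dist y z - 1/2 * exp (K * (a - a)) * dist y z)) {a..t}"
      by (rule fundamental_theorem_of_calculus)
        (use t in \<open>auto intro!: derivative_eq_intros
            simp: K_def simp flip: has_real_derivative_iff_has_vector_derivative\<close>)
    have "Q y t - Q z t = exp (- K * (t - a)) *\<^sub>R
        (integral {a..t} (\<lambda>s. f s (X y s)) - integral {a..t} (\<lambda>s. f s (X z s)))"
      unfolding Q_def by (simp add: algebra_simps)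
    also have "integral {a..t} (\<lambda>s. f s (X y s)) - integral {a..t} (\<lambda>s. f s (X z s))
        = integral {a..t} (\<lambda>s. f s (X y s) - f s (X z s))"
      by (intro integral_diff[symmetric] int t)
    finally have "norm (Q y t - Q z t)
        = exp (- K * (t - a)) * norm (integral {a..t} (\<lambda>s. f s (X y s) - f s (X z s)))"
      by simp
    also have "norm (integral {a..t} (\<lambda>s. f s (X y s) - f s (X z s)))
        \<le> integral {a..t} (\<lambda>s. L * exp (K * (s - a)) * dist y z)"
    proof (rule integral_norm_bound_integral)
      show "(\<lambda>s. f s (X y s) - f s (X z s)) integrable_on {a..t}"
        by (intro integrable_diff int t)
      show "(\<lambda>s. L * exp (K * (s - a)) * dist y z) integrable_on {a..t}"
        using I by blast
      fix s assume s: "s \<in> {a..t}"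
      have "norm (f s (X y s) - f s (X z s)) \<le> L * norm (X y s - X z s)"
        by (rule lip) (use s t in auto)
      also have "X y s - X z s = exp (K * (s - a)) *\<^sub>R (apply_bcontfun y s - apply_bcontfun z s)"
        by (simp add: X_def scaleR_diff_right)
      also have "norm \<dots> = exp (K * (s - a)) * dist (apply_bcontfun y s) (apply_bcontfun z s)"
        by (simp add: dist_norm)
      also have "dist (apply_bcontfun y s) (apply_bcontfun z s) \<le> dist y z"
        by (rule dist_bounded)
      finally show "norm (f s (X y s) - f s (X z s)) \<le> L * exp (K * (s - a)) * dist y z"
        using L by (simp add: mult.assoc)
    qed
    also have "\<dots> \<le> 1/2 * exp (K * (t - a)) * dist y z"
      using integral_unique[OF I] by simp
    finally have "norm (Q y t - Q z t)
        \<le> (exp (- K * (t - a)) * exp (K * (t - a))) * (1/2 * dist y z)"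
      by (simp add: algebra_simps)
    also have "exp (- K * (t - a)) * exp (K * (t - a)) = 1"
      by (simp flip: exp_add)
    finally show "dist (apply_bcontfun (Bcontfun (\<lambda>t. Q y (c t))) t0)
        (apply_bcontfun (Bcontfun (\<lambda>t. Q z (c t))) t0) \<le> 1/2 * dist y z"
      by (simp add: apply_P t_def dist_norm)
  qed
  obtain y where y: "Bcontfun (\<lambda>t. Q y (c t)) = y"
    using banach_fix_type[of "1/2" "\<lambda>y. Bcontfun (\<lambda>t. Q y (c t))"] contraction by auto
  have eq: "X y t = x0 + integral {a..t} (\<lambda>s. f s (X y s))" if "t \<in> {a..b}" for t
  proof -
    have "apply_bcontfun y t = Q y t"
      using apply_P[of y t] y c_id[OF that] by simp
    then have "X y t = (exp (K * (t - a)) * exp (- K * (t - a))) *\<^sub>R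
        (x0 + integral {a..t} (\<lambda>s. f s (X y s)))"
      unfolding X_def[of y t] Q_def by simp
    also have "exp (K * (t - a)) * exp (- K * (t - a)) = 1"
      by (simp flip: exp_add)
    finally show ?thesis by simp
  qed
  show ?thesis
  proof (intro exI[of _ "X y"] conjI ballI)
    show "X y a = x0" using eq[of a] ab by simp
    fix t assume t: "t \<in> {a..b}"
    have "((\<lambda>t. x0 + integral {a..t} (\<lambda>s. f s (X y s))) has_vector_derivative 0 + f t (X y t))
        (at t within {a..b})"
      by (intro has_vector_derivative_add has_vector_derivative_const
          integral_has_vector_derivative contf t)
    then show "(X y has_vector_derivative f t (X y t)) (at t within {a..b})"
      using has_vector_derivative_transform[OF t eq] by simp
  qed
qed

text \<open>The squared distance is differentiable even where the distance is not, and it satisfies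
  a linear differential inequality with initial value 0. The Lipschitz estimate is asked along the
  two curves only, which is what a locally Lipschitz field offers.\<close>

lemma picard_uniqueness:
  fixes f :: "real \<Rightarrow> 'a::real_inner \<Rightarrow> 'a"
  assumes dx: "\<And>t. t \<in> {a..b} \<Longrightarrow> (x has_vector_derivative f t (x t)) (at t within {a..b})"
    and dy: "\<And>t. t \<in> {a..b} \<Longrightarrow> (y has_vector_derivative f t (y t)) (at t within {a..b})"
    and lip: "\<And>t. t \<in> {a..b} \<Longrightarrow> norm (f t (x t) - f t (y t)) \<le> L * norm (x t - y t)"
    and init: "x a = y a" and t: "t \<in> {a..b}"
  shows "x t = y t"
proof -
  have "((\<lambda>t. (x t - y t) \<bullet> (x t - y t)) has_real_derivative
      2 * ((x t - y t) \<bullet> (f t (x t) - f t (y t)))) (at t within {a..b})"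
    if "t \<in> {a..b}" for t
    using dx[OF that] dy[OF that] unfolding has_vector_derivative_def has_field_derivative_def
    by (auto intro!: derivative_eq_intros simp: inner_commute algebra_simps inner_simps)
  moreover have "2 * ((x t - y t) \<bullet> (f t (x t) - f t (y t))) \<le> 2 * L * ((x t - y t) \<bullet> (x t - y t))"
    if "t \<in> {a..b}" for t
  proof -
    have "(x t - y t) \<bullet> (f t (x t) - f t (y t)) \<le> norm (x t - y t) * norm (f t (x t) - f t (y t))"
      by (rule norm_cauchy_schwarz)
    also have "\<dots> \<le> norm (x t - y t) * (L * norm (x t - y t))"
      by (intro mult_left_mono lip that) simp
    finally show ?thesis
      by (simp add: dot_square_norm power2_eq_square mult_ac)
  qed
  ultimately have "(x t - y t) \<bullet> (x t - y t) \<le> (x a - y a) \<bullet> (x a - y a) * exp (2 * L * (t - a))"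
    using t by (rule gronwall_exp)
  then have "x t - y t = 0"
    using init by (metis antisym cancel_comm_monoid_add_class.diff_cancel inner_eq_zero_iff
        inner_ge_zero inner_zero_left mult_zero_left)
  then show ?thesis by simp
qed

text \<open>The first time at which one of the two bounds fails cannot exist: both still hold there, and
  both functions are strictly increasing there.\<close>
lemma stay_above_initial_values:
  fixes f g :: "real \<Rightarrow> real"
  assumes df: "\<And>x. x \<in> {a..b} \<Longrightarrow> (f has_real_derivative f' x) (at x within {a..b})"
    and dg: "\<And>x. x \<in> {a..b} \<Longrightarrow> (g has_real_derivative g' x) (at x within {a..b})"
    and pos: "\<And>x. x \<in> {a..b} \<Longrightarrow> f x \<ge> f a \<Longrightarrow> g x \<ge> g a \<Longrightarrow> f' x > 0 \<and> g' x > 0"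
    and x: "x \<in> {a..b}"
  shows "f x \<ge> f a \<and> g x \<ge> g a"
proof (rule ccontr)
  assume neg: "\<not> ?thesis"
  define S where "S = {x \<in> {a..b}. f x < f a \<or> g x < g a}"
  define t where "t = Inf S"
  have S: "S \<noteq> {}" "bdd_below S"
    using neg x by (auto simp: S_def intro: bdd_belowI)
  have at: "a \<le> t" using S unfolding t_def by (intro cInf_greatest) (auto simp: S_def)
  have tx: "t \<le> x" using S neg x unfolding t_def by (intro cInf_lower) (auto simp: S_def)
  have t: "t \<in> {a..b}" using at tx x by auto
  have before: "f s \<ge> f a \<and> g s \<ge> g a" if "a \<le> s" "s < t" for s
  proof (rule ccontr)
    assume "\<not> ?thesis"
    then have "s \<in> S" using that t by (auto simp: S_def)
    then show False using cInf_lower[OF _ S(2)] that t_def by force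
  qed
  have cont: "continuous_on {a..b} f" "continuous_on {a..b} g"
    using DERIV_continuous_on[OF df] DERIV_continuous_on[OF dg] by auto
  have at_t: "h t \<ge> h a" if h: "continuous_on {a..b} h" "\<And>s. a \<le> s \<Longrightarrow> s < t \<Longrightarrow> h s \<ge> h a"
    for h :: "real \<Rightarrow> real"
  proof (cases "t = a")
    case False
    then have "closure {a..<t} = {a..t}" using at by simp
    moreover have "continuous_on (closure {a..<t}) h"
      using calculation t by (auto intro: continuous_on_subset[OF h(1)])
    ultimately show ?thesis
      using continuous_ge_on_closure[of "{a..<t}" h t "h a"] h(2) at by auto
  qed simp
  have ft: "f t \<ge> f a" and gt: "g t \<ge> g a"
    using at_t[OF cont(1)] at_t[OF cont(2)] before by auto
  have pt: "f' t > 0" "g' t > 0" using pos[OF t ft gt] by auto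
  obtain d1 where d1: "d1 > 0" "\<And>h. h > 0 \<Longrightarrow> t + h \<in> {a..b} \<Longrightarrow> h < d1 \<Longrightarrow> f t < f (t + h)"
    using has_real_derivative_pos_inc_right[OF df[OF t] pt(1)] by blast
  obtain d2 where d2: "d2 > 0" "\<And>h. h > 0 \<Longrightarrow> t + h \<in> {a..b} \<Longrightarrow> h < d2 \<Longrightarrow> g t < g (t + h)"
    using has_real_derivative_pos_inc_right[OF dg[OF t] pt(2)] by blast
  \<comment> \<open>The infimum is not itself in \<open>S\<close>, so members of \<open>S\<close>
    accumulate at it from the right, where both functions already exceed their values at
    \<open>t\<close>.\<close>
  obtain s where s: "s \<in> S" "s < t + min d1 d2"
    using cInf_lessD[OF S(1), of "t + min d1 d2"] d1(1) d2(1) t_def by auto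
  have "t \<le> s" using s S(2) t_def by (simp add: cInf_lower)
  moreover have "s \<noteq> t" using s(1) ft gt by (auto simp: S_def)
  ultimately have "s - t > 0" by simp
  then have "f t < f s" "g t < g s"
    using d1(2)[of "s - t"] d2(2)[of "s - t"] s by (auto simp: S_def)
  then show False using s(1) ft gt by (auto simp: S_def)
qed

section \<open>Smoothness via differential algebras of functions\<close>

text \<open>Only sums and products are built in. Reciprocals and real powers enter as extra
  generators, so that closure under differentiation has to be checked on finitely many
  functions.\<close>

inductive_set function_algebra :: "(real \<Rightarrow> real) set \<Rightarrow> (real \<Rightarrow> real) set" for G where
  generator: "g \<in> G \<Longrightarrow> g \<in> function_algebra G"
| const: "(\<lambda>_. c) \<in> function_algebra G"
| add: "f \<in> function_algebra G \<Longrightarrow> g \<in> function_algebra G \<Longrightarrow> (\<lambda>x. f x + g x) \<in> function_algebra G"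
| mult: "f \<in> function_algebra G \<Longrightarrow> g \<in> function_algebra G \<Longrightarrow> (\<lambda>x. f x * g x) \<in> function_algebra G"

lemma function_algebra_diff:
  assumes "f \<in> function_algebra G" "g \<in> function_algebra G"
  shows "(\<lambda>x. f x - g x) \<in> function_algebra G"
proof -
  have "(\<lambda>x. f x + (-1) * g x) \<in> function_algebra G"
    by (intro function_algebra.intros assms)
  then show ?thesis by simp
qed

lemma function_algebra_power:
  "f \<in> function_algebra G \<Longrightarrow> (\<lambda>x. f x ^ n) \<in> function_algebra G"
  by (induction n) (auto intro: function_algebra.intros)

text \<open>The sum and product rules carry differentiability within the algebra from the generators
  to all elements. Each derivative lies in the algebra again, so the process never stops.\<close>

lemma smooth_on_Icc_function_algebra:
  assumes gen: "\<And>g. g \<in> G \<Longrightarrow>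
      \<exists>g'\<in>function_algebra G. \<forall>x\<in>{a..b}. (g has_real_derivative g' x) (at x within {a..b})"
    and f: "f \<in> function_algebra G"
  shows "smooth_on_Icc a b f"
proof -
  have closed: "\<exists>f'\<in>function_algebra G. \<forall>x\<in>{a..b}. (f has_real_derivative f' x) (at x within {a..b})"
    if "f \<in> function_algebra G" for f
    using that
  proof induction
    case (generator g)
    then show ?case by (rule gen)
  next
    case (const c)
    show ?case by (rule bexI[of _ "\<lambda>_. 0"]) (auto intro: function_algebra.const)
  next
    case (add f g)
    then obtain f' g' where "f' \<in> function_algebra G" "g' \<in> function_algebra G"
      and d: "\<forall>x\<in>{a..b}. (f has_real_derivative f' x) (at x within {a..b})"
        "\<forall>x\<in>{a..b}. (g has_real_derivative g' x) (at x within {a..b})" by blast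
    then show ?case
      by (intro bexI[of _ "\<lambda>x. f' x + g' x"])
        (auto intro!: function_algebra.add derivative_intros)
  next
    case (mult f g)
    then obtain f' g' where "f' \<in> function_algebra G" "g' \<in> function_algebra G"
      and d: "\<forall>x\<in>{a..b}. (f has_real_derivative f' x) (at x within {a..b})"
        "\<forall>x\<in>{a..b}. (g has_real_derivative g' x) (at x within {a..b})" by blast
    with mult.hyps show ?case
      by (intro bexI[of _ "\<lambda>x. f' x * g x + f x * g' x"])
        (auto intro!: function_algebra.add function_algebra.mult derivative_eq_intros)
  qed
  \<comment> \<open>Choosing one derivative per function gives an operator on the algebra; its
    iterates are the sequence \<open>D\<close> in the definition of smoothness.\<close>
  then obtain der where d: "\<And>f. f \<in> function_algebra G \<Longrightarrow> der f \<in> function_algebra G"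
    "\<And>f x. f \<in> function_algebra G \<Longrightarrow> x \<in> {a..b} \<Longrightarrow>
      (f has_real_derivative der f x) (at x within {a..b})"
    by metis
  have "(der ^^ n) f \<in> function_algebra G" for n
    by (induction n) (auto intro: d f)
  then show ?thesis
    unfolding smooth_on_Icc_def
    by (intro exI[of _ "\<lambda>n. (der ^^ n) f"]) (auto intro: d)
qed

text \<open>The constant is uniform in the compact parameter. In the application the parameter is
  the pair of radius and \<open>w\<close>, and the real variable is the density.\<close>

lemma lipschitz_of_continuous_partial_derivative:
  fixes F D :: "'a::metric_space \<Rightarrow> real \<Rightarrow> real"
  assumes T: "compact T"
    and d: "\<And>t x. t \<in> T \<Longrightarrow> x \<in> {a..b} \<Longrightarrow> (F t has_real_derivative D t x) (at x within {a..b})"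
    and cont: "continuous_on (T \<times> {a..b}) (\<lambda>z. D (fst z) (snd z))"
  shows "\<exists>K>0. \<forall>t\<in>T. \<forall>x\<in>{a..b}. \<forall>y\<in>{a..b}. \<bar>F t x - F t y\<bar> \<le> K * \<bar>x - y\<bar>"
proof -
  have "bounded ((\<lambda>z. D (fst z) (snd z)) ` (T \<times> {a..b}))"
    by (intro compact_imp_bounded compact_continuous_image cont compact_Times T) auto
  then obtain K where K: "K > 0" "\<And>t x. t \<in> T \<Longrightarrow> x \<in> {a..b} \<Longrightarrow> norm (D t x) \<le> K"
    unfolding bounded_pos by force
  have "\<bar>F t x - F t y\<bar> \<le> K * \<bar>x - y\<bar>" if "t \<in> T" "x \<in> {a..b}" "y \<in> {a..b}" for t x y
    using field_differentiable_bound[OF convex_real_interval(5) d[OF that(1)] K(2)[OF that(1)]] that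
    by (simp add: abs_minus_commute)
  then show ?thesis using K(1) by blast
qed

section \<open>The reduced system for the density and the electric field\<close>

locale euler_poisson_data =
  fixes \<gamma> r0 b0 \<rho>0 U10 U20 A0 E0 :: real
  assumes \<gamma>: "\<gamma> > 1" and r0: "r0 > 0" and b0: "b0 > 0"
    and \<rho>0: "\<rho>0 > 0" and U10: "U10 > 0" and A0: "A0 > 0" and E0: "E0 > 0"
    and \<rho>0_gt: "\<rho>0 > b0"
    and radially_subsonic: "U10\<^sup>2 < \<gamma> * A0 * \<rho>0 powr (\<gamma> - 1)"
    and supersonic: "\<gamma> * A0 * \<rho>0 powr (\<gamma> - 1) < U10\<^sup>2 + U20\<^sup>2"
begin

text \<open>The first integrals \<open>r * \<rho> * U1\<close> and, below, \<open>r * U2\<close>,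
  evaluated at \<open>r0\<close>.\<close>

definition flux :: real where "flux = r0 * \<rho>0 * U10"

definition swirl :: real where "swirl = r0 * U20"

definition csq :: "real \<Rightarrow> real" where "csq x = \<gamma> * A0 * x powr (\<gamma> - 1)"

definition usq :: "real \<Rightarrow> real \<Rightarrow> real" where "usq r x = (flux / (r * x))\<^sup>2"

text \<open>Coefficient of the density derivative in the momentum equation; it vanishes where the
  radial Mach number is 1.\<close>

definition gap :: "real \<Rightarrow> real \<Rightarrow> real" where "gap r x = csq x - usq r x"

text \<open>The momentum equation solved for the density derivative, using
  \<open>U1' = - U1 * (1 / r + rho' / rho)\<close> from conservation of mass and
  \<open>P' = c^2 * rho'\<close>; here \<open>y / r\<close> is the electric field.\<close>

definition slope :: "real \<Rightarrow> real \<Rightarrow> real \<Rightarrow> real" where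
  "slope r x y = x * (y / r + (usq r x + (swirl / r)\<^sup>2) / r) / gap r x"

text \<open>The reduced system for the density and \<open>w r = r * E r\<close>, with \<open>U1 = flux / (r * \<rho>)\<close> and
  \<open>U2 = swirl / r\<close> eliminated.\<close>
definition field :: "real \<Rightarrow> real \<times> real \<Rightarrow> real \<times> real" where
  "field r z = (slope r (fst z) (snd z), r * (fst z - b0))"

text \<open>The lower bounds belong to the notion: they keep the curve in the region where
  \<open>gap\<close> is positive and the field is locally Lipschitz. That all smooth flows with
  these data obey them is part of \<open>sol_of_smooth_flow\<close>.\<close>

definition sol :: "real \<Rightarrow> (real \<Rightarrow> real) \<Rightarrow> (real \<Rightarrow> real) \<Rightarrow> bool" where
  "sol r1 \<rho> w \<longleftrightarrow> \<rho> r0 = \<rho>0 \<and> w r0 = r0 * E0 \<and>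
    (\<forall>r\<in>{r0..r1}. \<rho> r \<ge> \<rho>0 \<and> w r \<ge> r0 * E0 \<and>
      (\<rho> has_real_derivative slope r (\<rho> r) (w r)) (at r within {r0..r1}) \<and>
      (w has_real_derivative r * (\<rho> r - b0)) (at r within {r0..r1}))"

section \<open>Bounds for the reduced vector field\<close>

lemma flux_pos: "flux > 0"
  using r0 \<rho>0 U10 by (simp add: flux_def)

lemma csq_pos: "x > 0 \<Longrightarrow> csq x > 0"
  using \<gamma> A0 by (simp add: csq_def)

lemma csq_mono: "0 < x \<Longrightarrow> x \<le> y \<Longrightarrow> csq x \<le> csq y"
  unfolding csq_def using \<gamma> A0 by (intro mult_left_mono powr_mono2) auto

text \<open>Constant mass flux and a density of at least \<open>\<rho>0\<close> force
  \<open>U1\<close> to decay at least like \<open>r0 / r\<close>. The decaying bound serves the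
  sonic transition, the constant one the bound for \<open>gap\<close>.\<close>

lemma usq_le:
  assumes "r \<ge> r0" "x \<ge> \<rho>0"
  shows "usq r x \<le> U10\<^sup>2 * (r0 / r)\<^sup>2" "usq r x \<le> U10\<^sup>2"
proof -
  have "flux / (r * x) = U10 * (r0 / r) * (\<rho>0 / x)"
    by (simp add: flux_def)
  also have "\<dots> \<le> U10 * (r0 / r) * 1"
    using assms r0 \<rho>0 U10 by (intro mult_left_mono) auto
  finally have *: "flux / (r * x) \<le> U10 * (r0 / r)" by simp
  have nn: "0 \<le> flux / (r * x)"
    using assms r0 \<rho>0 flux_pos by simp
  show 1: "usq r x \<le> U10\<^sup>2 * (r0 / r)\<^sup>2"
    unfolding usq_def using power_mono[OF * nn] by (simp add: power_mult_distrib power_divide)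
  have "(r0 / r)\<^sup>2 \<le> 1"
    using assms r0 by (intro power_le_one) auto
  then have "U10\<^sup>2 * (r0 / r)\<^sup>2 \<le> U10\<^sup>2 * 1"
    by (intro mult_left_mono) auto
  with 1 show "usq r x \<le> U10\<^sup>2" by simp
qed

text \<open>Moving up from the initial radius and density raises the sound speed and lowers the
  radial speed, so the initial margin \<open>c^2 - U1^2\<close> is never lost.\<close>

lemma gap_pos: "r \<ge> r0 \<Longrightarrow> x \<ge> \<rho>0 \<Longrightarrow> gap r x > 0"
  using usq_le(2)[of r x] csq_mono[of \<rho>0 x] \<rho>0 radially_subsonic
  by (simp add: gap_def csq_def)

lemma slope_pos:
  assumes "r \<ge> r0" "x \<ge> \<rho>0" "y \<ge> r0 * E0"
  shows "slope r x y > 0"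
proof -
  have "0 < r0 * E0" using r0 E0 by simp
  then have "0 < y / r" "0 < r" "0 < x" using assms r0 \<rho>0 by (auto intro: divide_pos_pos)
  moreover have "0 \<le> (usq r x + (swirl / r)\<^sup>2) / r"
    using \<open>0 < r\<close> by (simp add: usq_def)
  ultimately show ?thesis
    unfolding slope_def using gap_pos[OF assms(1,2)]
    by (intro divide_pos_pos mult_pos_pos) auto
qed

text \<open>On a compact box the density derivative of \<open>slope\<close> is continuous, hence
  bounded, and \<open>slope\<close> is affine in \<open>y\<close> with bounded coefficient. The two
  variables are changed one after the other.\<close>

lemma field_lipschitz:
  "\<exists>K>0. \<forall>r\<in>{r0..L}. \<forall>x\<in>{\<rho>0..N}. \<forall>x'\<in>{\<rho>0..N}. \<forall>y\<in>{r0 * E0..W}. \<forall>y'\<in>{r0 * E0..W}.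
     norm (field r (x, y) - field r (x', y')) \<le> K * norm ((x, y) - (x', y'))"
proof -
  define num where "num r x y = x * (y / r + (usq r x + (swirl / r)\<^sup>2) / r)" for r x y
  \<comment> \<open>Since \<open>usq\<close> is proportional to \<open>1 / x^2\<close>, the product
    \<open>x * usq r x\<close> behaves like \<open>1 / x\<close>; hence the minus sign.\<close>
  define num' where "num' r x y = y / r + (swirl / r)\<^sup>2 / r - usq r x / r" for r x y
  define gap' where "gap' r x = (\<gamma> - 1) * csq x / x + 2 * usq r x / x" for r x
  have slope_eq: "slope r x y = num r x y / gap r x" for r x y
    by (simp add: slope_def num_def)
  have dusq: "(usq r has_real_derivative - 2 * usq r x / x) (at x within S)"
    if "r > 0" "x > 0" for r x S
    unfolding usq_def using that
    by (auto intro!: derivative_eq_intros simp: field_simps power2_eq_square)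
  have dnum: "((\<lambda>x. num r x y) has_real_derivative num' r x y) (at x within S)"
    if "r > 0" "x > 0" for r x y S
    unfolding num_def num'_def using that
    by (auto intro!: derivative_eq_intros dusq simp: field_simps)
  have dcsq: "(csq has_real_derivative (\<gamma> - 1) * csq x / x) (at x within S)" if "x > 0" for x S
  proof -
    have "((\<lambda>x. \<gamma> * A0 * x powr (\<gamma> - 1)) has_real_derivative
        \<gamma> * A0 * ((\<gamma> - 1) * x powr (\<gamma> - 1 - 1))) (at x within S)"
      by (intro DERIV_cmult has_field_derivative_at_within[OF has_real_derivative_powr] that)
    moreover have "x powr (\<gamma> - 1 - 1) = x powr (\<gamma> - 1) / x"
      using that by (subst powr_diff) auto
    ultimately show ?thesis by (simp add: csq_def[abs_def] mult_ac)
  qed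
  have dgap: "(gap r has_real_derivative gap' r x) (at x within S)"
    if "r > 0" "x > 0" for r x S
    unfolding gap_def gap'_def
    by (auto intro!: derivative_eq_intros dcsq dusq that)
  define D where "D z x = (num' (fst z) x (snd z) * gap (fst z) x - num (fst z) x (snd z) * gap' (fst z) x)
      / (gap (fst z) x)\<^sup>2" for z x
  let ?T = "{r0..L} \<times> {r0 * E0..W}"
  have dslope: "((\<lambda>x. slope (fst z) x (snd z)) has_real_derivative D z x) (at x within {\<rho>0..N})"
    if "z \<in> ?T" "x \<in> {\<rho>0..N}" for z x
  proof -
    have "fst z > 0" "x > 0" "gap (fst z) x \<noteq> 0"
      using that r0 \<rho>0 gap_pos[of "fst z" x] by auto
    then show ?thesis
      unfolding slope_eq D_def
      by (auto intro!: derivative_eq_intros dnum dgap simp: power2_eq_square)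
  qed
  have "continuous_on (?T \<times> {\<rho>0..N}) (\<lambda>z. D (fst z) (snd z))"
  proof -
    have "fst (fst z) \<noteq> 0 \<and> snd z \<noteq> 0 \<and> gap (fst (fst z)) (snd z) \<noteq> 0"
      if "z \<in> ?T \<times> {\<rho>0..N}" for z
      using that r0 \<rho>0 gap_pos[of "fst (fst z)" "snd z"] by auto
    then show ?thesis
      unfolding D_def num_def num'_def gap'_def gap_def usq_def csq_def
      by (intro continuous_intros) auto
  qed
  from lipschitz_of_continuous_partial_derivative[OF compact_Times[OF compact_Icc compact_Icc] dslope this]
  obtain K1 where K1: "K1 > 0" and K1': "\<forall>z\<in>?T. \<forall>x\<in>{\<rho>0..N}. \<forall>x'\<in>{\<rho>0..N}.
      \<bar>slope (fst z) x (snd z) - slope (fst z) x' (snd z)\<bar> \<le> K1 * \<bar>x - x'\<bar>"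
    by blast
  have lip1: "\<bar>slope r x y - slope r x' y\<bar> \<le> K1 * \<bar>x - x'\<bar>"
    if "r \<in> {r0..L}" "y \<in> {r0 * E0..W}" "x \<in> {\<rho>0..N}" "x' \<in> {\<rho>0..N}" for r y x x'
    using bspec[OF K1', of "(r, y)"] that by simp
  have "continuous_on ({r0..L} \<times> {\<rho>0..N}) (\<lambda>z. snd z / (fst z * gap (fst z) (snd z)))"
  proof -
    have "fst z \<noteq> 0 \<and> snd z \<noteq> 0 \<and> gap (fst z) (snd z) \<noteq> 0"
      if "z \<in> {r0..L} \<times> {\<rho>0..N}" for z
      using that r0 \<rho>0 gap_pos[of "fst z" "snd z"] by auto
    then show ?thesis
      unfolding gap_def usq_def csq_def by (intro continuous_intros) auto
  qed
  then have "bounded ((\<lambda>z. snd z / (fst z * gap (fst z) (snd z))) ` ({r0..L} \<times> {\<rho>0..N}))"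
    by (intro compact_imp_bounded compact_continuous_image compact_Times) auto
  then obtain K2 where K2: "K2 > 0"
    and K2': "\<forall>z\<in>{r0..L} \<times> {\<rho>0..N}. norm (snd z / (fst z * gap (fst z) (snd z))) \<le> K2"
    unfolding bounded_pos by blast
  have bd: "\<bar>x / (r * gap r x)\<bar> \<le> K2" if "r \<in> {r0..L}" "x \<in> {\<rho>0..N}" for r x
    using bspec[OF K2', of "(r, x)"] that by simp
  have "norm (field r (x, y) - field r (x', y')) \<le> (K1 + K2 + \<bar>L\<bar>) * norm ((x, y) - (x', y'))"
    if h: "r \<in> {r0..L}" "x \<in> {\<rho>0..N}" "x' \<in> {\<rho>0..N}" "y \<in> {r0 * E0..W}" "y' \<in> {r0 * E0..W}"
    for r x x' y y'
  proof -
    let ?n = "norm ((x, y) - (x', y'))"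
    have nx: "\<bar>x - x'\<bar> \<le> ?n" and ny: "\<bar>y - y'\<bar> \<le> ?n"
      using norm_fst_le[of "x - x'" "y - y'"] norm_snd_le[of "y - y'" "x - x'"] by auto
    have "slope r x' y - slope r x' y' = (y - y') * (x' / (r * gap r x'))"
      using h r0 gap_pos[of r x'] by (simp add: slope_def field_simps)
    then have "\<bar>slope r x' y - slope r x' y'\<bar> = \<bar>x' / (r * gap r x')\<bar> * \<bar>y - y'\<bar>"
      by (simp add: abs_mult)
    also have "\<dots> \<le> K2 * ?n"
      using bd[OF h(1,3)] ny K2 by (intro mult_mono) auto
    finally have 1: "\<bar>slope r x' y - slope r x' y'\<bar> \<le> K2 * ?n" .
    have "\<bar>slope r x y - slope r x' y\<bar> \<le> K1 * \<bar>x - x'\<bar>"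
      by (rule lip1) (use h in auto)
    also have "\<dots> \<le> K1 * ?n"
      using nx K1 by (intro mult_left_mono) auto
    finally have 2: "\<bar>slope r x y - slope r x' y\<bar> \<le> K1 * ?n" .
    have "\<bar>r * (x - b0) - r * (x' - b0)\<bar> = \<bar>r\<bar> * \<bar>x - x'\<bar>"
      by (simp add: algebra_simps flip: abs_mult)
    also have "\<dots> \<le> \<bar>L\<bar> * ?n"
      using nx h r0 by (intro mult_mono) auto
    finally have 3: "\<bar>r * (x - b0) - r * (x' - b0)\<bar> \<le> \<bar>L\<bar> * ?n" .
    have "norm (field r (x, y) - field r (x', y'))
        \<le> \<bar>slope r x y - slope r x' y'\<bar> + \<bar>r * (x - b0) - r * (x' - b0)\<bar>"
      unfolding field_def by (simp add: norm_Pair sqrt_sum_squares_le_sum_abs)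
    then show ?thesis
      using 1 2 3 by (simp add: algebra_simps)
  qed
  then show ?thesis
    using K1 K2 by (intro exI[of _ "K1 + K2 + \<bar>L\<bar>"]) auto
qed

section \<open>Monotonicity, uniqueness and continuation\<close>

lemma sol_mono:
  assumes "sol r1 \<rho> w"
  shows "mono_on {r0..r1} \<rho>" "mono_on {r0..r1} w"
proof -
  show "mono_on {r0..r1} \<rho>"
    by (rule mono_on_of_nonneg_derivative_within[where f' = "\<lambda>r. slope r (\<rho> r) (w r)"])
      (use assms slope_pos in \<open>auto simp: sol_def intro: less_imp_le\<close>)
  show "mono_on {r0..r1} w"
    by (rule mono_on_of_nonneg_derivative_within[where f' = "\<lambda>r. r * (\<rho> r - b0)"])
      (use assms r0 \<rho>0_gt in \<open>auto simp: sol_def intro!: mult_nonneg_nonneg dest!: bspec\<close>)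
qed

lemma sol_subset:
  assumes "sol r1 \<rho> w" "r2 \<le> r1"
  shows "sol r2 \<rho> w"
  using assms unfolding sol_def
  by (fastforce intro: has_field_derivative_subset[of _ _ _ "{r0..r1}"])

text \<open>Monotone solutions stay below their values at \<open>r1\<close>, so both lie in one box
  on which the field is Lipschitz.\<close>

lemma sol_unique:
  assumes s: "sol r1 \<rho> w" and s': "sol r1 \<rho>' w'" and r: "r \<in> {r0..r1}"
  shows "\<rho>' r = \<rho> r \<and> w' r = w r"
proof -
  define N where "N = max (\<rho> r1) (\<rho>' r1)"
  define W where "W = max (w r1) (w' r1)"
  obtain K where K: "\<And>r x x' y y'. r \<in> {r0..r1} \<Longrightarrow> x \<in> {\<rho>0..N} \<Longrightarrow> x' \<in> {\<rho>0..N} \<Longrightarrow>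
      y \<in> {r0 * E0..W} \<Longrightarrow> y' \<in> {r0 * E0..W} \<Longrightarrow>
      norm (field r (x, y) - field r (x', y')) \<le> K * norm ((x, y) - (x', y'))"
    using field_lipschitz[of r1 N W] by blast
  have der: "((\<lambda>t. (\<rho> t, w t)) has_vector_derivative field t (\<rho> t, w t)) (at t within {r0..r1})"
    if "sol r1 \<rho> w" "t \<in> {r0..r1}" for \<rho> w t
    using that unfolding sol_def field_def
    by (auto intro!: has_vector_derivative_Pair simp flip: has_real_derivative_iff_has_vector_derivative)
  have box: "\<rho> t \<in> {\<rho>0..\<rho> r1} \<and> w t \<in> {r0 * E0..w r1}"
    if "sol r1 \<rho> w" "t \<in> {r0..r1}" for \<rho> w t
    using that sol_mono[OF that(1)] by (auto simp: sol_def monotone_on_def)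
  have "(\<rho>' r, w' r) = (\<rho> r, w r)"
  proof (rule picard_uniqueness[OF der[OF s'] der[OF s] _ _ r])
    fix t assume "t \<in> {r0..r1}"
    then show "norm (field t (\<rho>' t, w' t) - field t (\<rho> t, w t)) \<le> K * norm ((\<rho>' t, w' t) - (\<rho> t, w t))"
      using box[OF s] box[OF s'] by (intro K) (force simp: N_def W_def)+
  qed (use s s' in \<open>auto simp: sol_def\<close>)
  then show ?thesis by simp
qed

text \<open>The vector field is truncated at the density \<open>N\<close>, which makes it globally Lipschitz; up to the
  radius where the density reaches \<open>N\<close> the truncation is not felt. The truncation in the second
  component is at an a priori bound for it.\<close>
lemma sol_until_density:
  assumes N: "N > \<rho>0" and L: "L > r0"
  obtains r \<rho> w where "r0 < r" "r \<le> L" "sol r \<rho> w" "r = L \<or> \<rho> r = N"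
proof -
  \<comment> \<open>While the density is clamped to at most \<open>N\<close>, the rate
    \<open>r * (\<rho> - b0)\<close> is at most \<open>L * N\<close>; \<open>W\<close> is the
    resulting bound for \<open>w\<close> on \<open>[r0, L]\<close>.\<close>
  define W where "W = r0 * E0 + L * N * (L - r0)"
  have W: "r0 * E0 \<le> W" using N L r0 \<rho>0 by (simp add: W_def)
  define cx where "cx x = max \<rho>0 (min N x)" for x
  define cy where "cy y = max (r0 * E0) (min W y)" for y
  define cl where "cl z = (cx (fst z), cy (snd z))" for z
  have cx: "cx x \<in> {\<rho>0..N}" for x using N by (auto simp: cx_def)
  have cy: "cy y \<in> {r0 * E0..W}" for y using W by (auto simp: cy_def)
  obtain K where Kpos: "K > 0" and K: "\<And>r x x' y y'. r \<in> {r0..L} \<Longrightarrow> x \<in> {\<rho>0..N} \<Longrightarrow>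
      x' \<in> {\<rho>0..N} \<Longrightarrow> y \<in> {r0 * E0..W} \<Longrightarrow> y' \<in> {r0 * E0..W} \<Longrightarrow>
      norm (field r (x, y) - field r (x', y')) \<le> K * norm ((x, y) - (x', y'))"
    using field_lipschitz[of L N W] by blast
  have cl_le: "norm (cl z - cl z') \<le> norm (z - z')" for z z'
  proof -
    have "\<bar>cx (fst z) - cx (fst z')\<bar> \<le> \<bar>fst z - fst z'\<bar>" "\<bar>cy (snd z) - cy (snd z')\<bar> \<le> \<bar>snd z - snd z'\<bar>"
      by (auto simp: cx_def cy_def)
    then have "(cx (fst z) - cx (fst z'))\<^sup>2 + (cy (snd z) - cy (snd z'))\<^sup>2
        \<le> (fst z - fst z')\<^sup>2 + (snd z - snd z')\<^sup>2"
      by (intro add_mono) (simp_all add: abs_le_square_iff)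
    then show ?thesis
      by (simp add: cl_def norm_prod_def)
  qed
  have "\<exists>z. z r0 = (\<rho>0, r0 * E0) \<and>
      (\<forall>t\<in>{r0..L}. (z has_vector_derivative field t (cl (z t))) (at t within {r0..L}))"
  proof (rule picard_existence[OF _ Kpos])
    fix z :: "real \<Rightarrow> real \<times> real" assume z: "continuous_on {r0..L} z"
    have "continuous_on {r0..L} (\<lambda>t. cx (fst (z t)))" "continuous_on {r0..L} (\<lambda>t. cy (snd (z t)))"
      unfolding cx_def cy_def by (intro continuous_intros z)+
    moreover have "t \<noteq> 0 \<and> cx (fst (z t)) \<noteq> 0 \<and> gap t (cx (fst (z t))) \<noteq> 0" if "t \<in> {r0..L}" for t
      using that r0 \<rho>0 gap_pos[of t "cx (fst (z t))"] cx[of "fst (z t)"] by auto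
    ultimately show "continuous_on {r0..L} (\<lambda>t. field t (cl (z t)))"
      unfolding field_def cl_def slope_def gap_def usq_def csq_def fst_conv snd_conv
      by (intro continuous_intros) auto
  next
    fix t z z' assume t: "t \<in> {r0..L}"
    have "norm (field t (cl z) - field t (cl z')) \<le> K * norm (cl z - cl z')"
      unfolding cl_def by (intro K t cx cy)
    also have "\<dots> \<le> K * norm (z - z')"
      using Kpos cl_le by (intro mult_left_mono) auto
    finally show "norm (field t (cl z) - field t (cl z')) \<le> K * norm (z - z')" .
  qed (use L in auto)
  then obtain z where z0: "z r0 = (\<rho>0, r0 * E0)"
    and z: "\<And>t. t \<in> {r0..L} \<Longrightarrow> (z has_vector_derivative field t (cl (z t))) (at t within {r0..L})"
    by blast
  define \<rho> where "\<rho> t = fst (z t)" for t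
  define w where "w t = snd (z t)" for t
  have d\<rho>: "(\<rho> has_real_derivative slope t (cx (\<rho> t)) (cy (w t))) (at t within {r0..L})"
    and dw: "(w has_real_derivative t * (cx (\<rho> t) - b0)) (at t within {r0..L})"
    if "t \<in> {r0..L}" for t
    using has_derivative_fst[OF z[OF that, unfolded has_vector_derivative_def]]
      has_derivative_snd[OF z[OF that, unfolded has_vector_derivative_def]]
    unfolding has_real_derivative_iff_has_vector_derivative has_vector_derivative_def \<rho>_def w_def
    by (simp_all add: field_def cl_def)
  have m\<rho>: "mono_on {r0..L} \<rho>"
    by (rule mono_on_of_nonneg_derivative_within[OF d\<rho>])
      (use cx cy slope_pos in \<open>auto intro!: less_imp_le\<close>)
  have mw: "mono_on {r0..L} w"
  proof (rule mono_on_of_nonneg_derivative_within[OF dw])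
    fix t assume "t \<in> {r0..L}"
    then show "0 \<le> t * (cx (\<rho> t) - b0)"
      using cx[of "\<rho> t"] r0 \<rho>0_gt by simp
  qed
  have mW: "mono_on {r0..L} (\<lambda>t. L * N * t - w t)"
  proof (rule mono_on_of_nonneg_derivative_within)
    fix t assume t: "t \<in> {r0..L}"
    then show "((\<lambda>t. L * N * t - w t) has_real_derivative L * N - t * (cx (\<rho> t) - b0)) (at t within {r0..L})"
      by (auto intro!: derivative_eq_intros dw)
    have "t * (cx (\<rho> t) - b0) \<le> L * N"
      using t cx[of "\<rho> t"] r0 b0 \<rho>0_gt by (intro mult_mono) auto
    then show "0 \<le> L * N - t * (cx (\<rho> t) - b0)" by simp
  qed
  have init: "\<rho> r0 = \<rho>0" "w r0 = r0 * E0" using z0 by (simp_all add: \<rho>_def w_def)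
  have \<rho>_ge: "\<rho> t \<ge> \<rho>0" and w_ge: "w t \<ge> r0 * E0" if "t \<in> {r0..L}" for t
    using mono_onD[OF m\<rho>, of r0 t] mono_onD[OF mw, of r0 t] that init by auto
  have w_le: "w t \<le> W" if "t \<in> {r0..L}" for t
  proof -
    have "w t \<le> r0 * E0 + L * N * (t - r0)"
      using mono_onD[OF mW, of r0 t] that init by (auto simp: algebra_simps)
    also have "L * N * (t - r0) \<le> L * N * (L - r0)"
      using that L N r0 \<rho>0 by (intro mult_left_mono) auto
    finally show ?thesis by (simp add: W_def)
  qed
  have genuine: "sol r \<rho> w" if "r0 \<le> r" "r \<le> L" "\<rho> r \<le> N" for r
    unfolding sol_def
  proof (intro conjI ballI init)
    fix t assume t: "t \<in> {r0..r}"
    then have tL: "t \<in> {r0..L}" using that by auto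
    show "\<rho>0 \<le> \<rho> t" "r0 * E0 \<le> w t" using \<rho>_ge w_ge tL by auto
    have "\<rho> t \<le> N" using mono_onD[OF m\<rho>, of t r] t that by auto
    then have "cx (\<rho> t) = \<rho> t" "cy (w t) = w t"
      using \<rho>_ge w_ge w_le tL by (auto simp: cx_def cy_def)
    then show "(\<rho> has_real_derivative slope t (\<rho> t) (w t)) (at t within {r0..r})"
      "(w has_real_derivative t * (\<rho> t - b0)) (at t within {r0..r})"
      using d\<rho>[OF tL] dw[OF tL] that by (auto intro: has_field_derivative_subset)
  qed
  show thesis
  proof (cases "\<rho> L \<le> N")
    case True
    then show thesis using that genuine[of L] L by auto
  next
    case False
    \<comment> \<open>A radius with density exactly \<open>N\<close> exists by the intermediate
      value theorem, and by monotonicity the density is at most \<open>N\<close> before it.\<close>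
    have "continuous_on {r0..L} \<rho>" by (rule DERIV_continuous_on[OF d\<rho>])
    then obtain r where r: "r0 \<le> r" "r \<le> L" "\<rho> r = N"
      using IVT'[of \<rho> r0 N L] False N L init by auto
    moreover have "r \<noteq> r0" using r N init by auto
    ultimately show thesis using that[of r \<rho> w] genuine[of r] by auto
  qed
qed

text \<open>Aim at radius \<open>r1 + 1\<close> and density \<open>\<rho> r1 + 1\<close>. Stopping
  at or before \<open>r1\<close> is impossible: there the new solution coincides with the old one,
  whose density is at most \<open>\<rho> r1\<close>.\<close>

lemma sol_extend:
  assumes "sol r1 \<rho> w" "r1 \<ge> r0"
  obtains r2 \<rho>' w' where "r2 > r1" "sol r2 \<rho>' w'"
proof -
  have "\<rho> r1 \<ge> \<rho>0" using assms by (auto simp: sol_def)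
  then have N: "\<rho> r1 + 1 > \<rho>0" and L: "r1 + 1 > r0" using assms(2) by auto
  obtain r \<rho>' w' where r: "r0 < r" "sol r \<rho>' w'" "r = r1 + 1 \<or> \<rho>' r = \<rho> r1 + 1"
    using sol_until_density[OF N L] by metis
  have "r > r1"
  proof (rule ccontr)
    assume "\<not> r > r1"
    then have "\<rho>' r = \<rho> r"
      using sol_unique[of r \<rho> w \<rho>' w' r] sol_subset[OF assms(1), of r] r by auto
    moreover have "\<rho> r \<le> \<rho> r1"
      using sol_mono(1)[OF assms(1)] r \<open>\<not> r > r1\<close> by (auto simp: monotone_on_def)
    ultimately show False using r \<open>\<not> r > r1\<close> by auto
  qed
  with r that show thesis by blast
qed

section \<open>Flows and solutions of the reduced system\<close>

lemma smooth_flow_of_sol: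
  assumes s: "sol r1 \<rho> w" and r1: "r1 > r0"
  shows "smooth_flow \<gamma> b0 r0 r1 \<rho> (\<lambda>r. flux / (r * \<rho> r)) (\<lambda>r. swirl / r) (\<lambda>_. A0) (\<lambda>r. w r / r)"
proof -
  let ?I = "{r0..r1}"
  have pos: "r > 0" "\<rho> r > 0" "gap r (\<rho> r) > 0" if "r \<in> ?I" for r
    using that s r0 \<rho>0 gap_pos[of r "\<rho> r"] by (auto simp: sol_def dest!: bspec[of _ _ r])
  have d\<rho>: "(\<rho> has_real_derivative slope r (\<rho> r) (w r)) (at r within ?I)"
    and dw: "(w has_real_derivative r * (\<rho> r - b0)) (at r within ?I)" if "r \<in> ?I" for r
    using s that by (auto simp: sol_def)

  \<comment> \<open>Besides the unknowns, the generators must contain every nonpolynomial expression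
    in the equations: the reciprocals of radius, density and gap, and the real power in the sound
    speed.\<close>
  define iv where "iv r = 1 / r" for r :: real
  define i\<rho> where "i\<rho> r = 1 / \<rho> r" for r
  define p where "p r = \<rho> r powr (\<gamma> - 1)" for r
  define q where "q r = 1 / gap r (\<rho> r)" for r
  \<comment> \<open>\<open>u\<close>, \<open>sl\<close> and \<open>gp'\<close> are
    \<open>usq\<close>, \<open>slope\<close> and the derivative of the gap along the solution,
    rewritten as polynomials in the generators so that membership in the algebra is
    syntactic.\<close>
  define u where "u = (\<lambda>r. (flux * (iv r * i\<rho> r))\<^sup>2)"
  define sl where "sl = (\<lambda>r. \<rho> r * (w r * iv r + (u r + (swirl * iv r)\<^sup>2) * iv r) * q r)"
  define gp' where "gp' = (\<lambda>r. \<gamma> * A0 * ((\<gamma> - 1) * (p r * i\<rho> r * sl r))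
      + 2 * (u r * (iv r + i\<rho> r * sl r)))"
  let ?G = "{\<lambda>r. r, iv, \<rho>, i\<rho>, p, w, q}"
  let ?A = "function_algebra ?G"
  note fa = function_algebra.add function_algebra.mult function_algebra.const
    function_algebra_diff function_algebra_power
  have gen: "(\<lambda>r. r) \<in> ?A" "iv \<in> ?A" "\<rho> \<in> ?A" "i\<rho> \<in> ?A" "p \<in> ?A" "w \<in> ?A" "q \<in> ?A"
    by (auto intro: function_algebra.generator)
  have u: "u \<in> ?A" unfolding u_def by (intro fa gen)
  have sl: "sl \<in> ?A" unfolding sl_def by (intro fa gen u)
  have gp': "gp' \<in> ?A" unfolding gp'_def by (intro fa gen u sl)
  have usq_eq: "usq r (\<rho> r) = u r" for r
    by (simp add: usq_def u_def iv_def i\<rho>_def)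
  have sl_eq: "slope r (\<rho> r) (w r) = sl r" for r
    by (simp add: slope_def sl_def usq_eq iv_def q_def)
  have d\<rho>': "(\<rho> has_real_derivative sl r) (at r within ?I)" if "r \<in> ?I" for r
    using d\<rho>[OF that] by (simp add: sl_eq)
  have div: "(iv has_real_derivative - 1 * (iv r)\<^sup>2) (at r within ?I)" if "r \<in> ?I" for r
    unfolding iv_def using pos[OF that]
    by (auto intro!: derivative_eq_intros simp: power2_eq_square)
  have di\<rho>: "(i\<rho> has_real_derivative - 1 * (sl r * (i\<rho> r)\<^sup>2)) (at r within ?I)" if "r \<in> ?I" for r
    unfolding i\<rho>_def using pos[OF that] d\<rho>'[OF that]
    by (auto intro!: derivative_eq_intros simp: power2_eq_square)
  have dp: "(p has_real_derivative (\<gamma> - 1) * (p r * i\<rho> r * sl r)) (at r within ?I)" if "r \<in> ?I" for r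
  proof -
    have "(p has_real_derivative (\<gamma> - 1) * \<rho> r powr (\<gamma> - 1 - 1) * sl r) (at r within ?I)"
      unfolding p_def using pos[OF that]
      by (intro DERIV_chain2[OF has_real_derivative_powr d\<rho>'[OF that]])
    moreover have "\<rho> r powr (\<gamma> - 1 - 1) = p r * i\<rho> r"
      using pos[OF that] unfolding p_def i\<rho>_def by (subst powr_diff) auto
    ultimately show ?thesis by (simp add: mult.assoc)
  qed
  have du: "(u has_real_derivative - 2 * (u r * (iv r + i\<rho> r * sl r))) (at r within ?I)"
    if "r \<in> ?I" for r
    unfolding u_def
    by (auto intro!: derivative_eq_intros div[OF that] di\<rho>[OF that] simp: power2_eq_square algebra_simps)
  have gap_eq: "(\<lambda>r. gap r (\<rho> r)) = (\<lambda>r. \<gamma> * A0 * p r - u r)"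
    by (simp add: gap_def csq_def p_def usq_eq)
  have dgap: "((\<lambda>r. gap r (\<rho> r)) has_real_derivative gp' r) (at r within ?I)" if "r \<in> ?I" for r
    unfolding gap_eq gp'_def
    by (auto intro!: derivative_eq_intros dp[OF that] du[OF that] simp: algebra_simps)
  have dq: "(q has_real_derivative - 1 * (gp' r * (q r)\<^sup>2)) (at r within ?I)" if "r \<in> ?I" for r
    unfolding q_def using pos[OF that] dgap[OF that]
    by (auto intro!: derivative_eq_intros simp: power2_eq_square)
  have closed: "\<exists>g'\<in>?A. \<forall>r\<in>?I. (g has_real_derivative g' r) (at r within ?I)" if "g \<in> ?G" for g
    using that
  proof (elim insertE emptyE; hypsubst)
    show "\<exists>g'\<in>?A. \<forall>r\<in>?I. ((\<lambda>r. r) has_real_derivative g' r) (at r within ?I)"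
      by (intro bexI[of _ "\<lambda>_. 1"] fa) auto
    show "\<exists>g'\<in>?A. \<forall>r\<in>?I. (iv has_real_derivative g' r) (at r within ?I)"
      by (intro bexI[of _ "\<lambda>r. - 1 * (iv r)\<^sup>2"] ballI div fa gen)
    show "\<exists>g'\<in>?A. \<forall>r\<in>?I. (\<rho> has_real_derivative g' r) (at r within ?I)"
      by (intro bexI[of _ sl] ballI d\<rho>' sl)
    show "\<exists>g'\<in>?A. \<forall>r\<in>?I. (i\<rho> has_real_derivative g' r) (at r within ?I)"
      by (intro bexI[of _ "\<lambda>r. - 1 * (sl r * (i\<rho> r)\<^sup>2)"] ballI di\<rho> fa gen sl)
    show "\<exists>g'\<in>?A. \<forall>r\<in>?I. (p has_real_derivative g' r) (at r within ?I)"
      by (intro bexI[of _ "\<lambda>r. (\<gamma> - 1) * (p r * i\<rho> r * sl r)"] ballI dp fa gen sl)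
    show "\<exists>g'\<in>?A. \<forall>r\<in>?I. (w has_real_derivative g' r) (at r within ?I)"
      by (intro bexI[of _ "\<lambda>r. r * (\<rho> r - b0)"] ballI dw fa gen)
    show "\<exists>g'\<in>?A. \<forall>r\<in>?I. (q has_real_derivative g' r) (at r within ?I)"
      by (intro bexI[of _ "\<lambda>r. - 1 * (gp' r * (q r)\<^sup>2)"] ballI dq fa gen gp')
  qed
  have smooth: "smooth_on_Icc r0 r1 f" if "f \<in> ?A" for f
    by (rule smooth_on_Icc_function_algebra[OF closed that])
  have smooth_all: "smooth_on_Icc r0 r1 \<rho>" "smooth_on_Icc r0 r1 (\<lambda>r. flux / (r * \<rho> r))"
    "smooth_on_Icc r0 r1 (\<lambda>r. swirl / r)" "smooth_on_Icc r0 r1 (\<lambda>_. A0)" "smooth_on_Icc r0 r1 (\<lambda>r. w r / r)"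
  proof -
    have "(\<lambda>r. flux * (iv r * i\<rho> r)) \<in> ?A" "(\<lambda>r. swirl * iv r) \<in> ?A" "(\<lambda>r. w r * iv r) \<in> ?A"
      "(\<lambda>_. A0) \<in> ?A"
      by (intro fa gen)+
    from this[THEN smooth] smooth[OF gen(3)] show "smooth_on_Icc r0 r1 \<rho>"
      "smooth_on_Icc r0 r1 (\<lambda>r. flux / (r * \<rho> r))" "smooth_on_Icc r0 r1 (\<lambda>r. swirl / r)"
      "smooth_on_Icc r0 r1 (\<lambda>_. A0)" "smooth_on_Icc r0 r1 (\<lambda>r. w r / r)"
      by (simp_all add: iv_def i\<rho>_def)
  qed

  note ddrI = ddr_eqI[OF r1]
  have eqs: "\<rho> r > 0 \<and>
      ddr r0 r1 (\<lambda>s. s * \<rho> s * (flux / (s * \<rho> s))) r = 0 \<and>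
      flux / (r * \<rho> r) * ddr r0 r1 (\<lambda>r. flux / (r * \<rho> r)) r
        + 1 / \<rho> r * ddr r0 r1 (pressure \<gamma> \<rho> (\<lambda>_. A0)) r - 1 / r * (swirl / r)\<^sup>2 = w r / r \<and>
      flux / (r * \<rho> r) * ddr r0 r1 (\<lambda>r. swirl / r) r + 1 / r * (flux / (r * \<rho> r)) * (swirl / r) = 0 \<and>
      flux / (r * \<rho> r) * ddr r0 r1 (\<lambda>_. A0) r = 0 \<and>
      ddr r0 r1 (\<lambda>r. w r / r) r + 1 / r * (w r / r) = \<rho> r - b0"
    if r: "r \<in> ?I" for r
  proof -
    note pr = pos[OF r]
    have 1: "ddr r0 r1 (\<lambda>s. s * \<rho> s * (flux / (s * \<rho> s))) r = 0"
    proof (rule ddrI[OF r])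
      have "s * \<rho> s * (flux / (s * \<rho> s)) = flux" if "s \<in> ?I" for s
        using pos[OF that] by simp
      then show "((\<lambda>s. s * \<rho> s * (flux / (s * \<rho> s))) has_real_derivative 0) (at r within ?I)"
        by (rule has_real_derivative_transform[OF r]) auto
    qed
    have 2: "ddr r0 r1 (\<lambda>r. flux / (r * \<rho> r)) r = - flux / (r * \<rho> r) * (1 / r + sl r / \<rho> r)"
      by (rule ddrI[OF r])
        (use pr in \<open>auto intro!: derivative_eq_intros d\<rho>'[OF r] simp: field_simps\<close>)
    have 3: "ddr r0 r1 (pressure \<gamma> \<rho> (\<lambda>_. A0)) r = csq (\<rho> r) * sl r"
    proof (rule ddrI[OF r])
      have "((\<lambda>r. A0 * \<rho> r powr \<gamma>) has_real_derivative A0 * (\<gamma> * \<rho> r powr (\<gamma> - 1) * sl r)) (at r within ?I)"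
        by (intro DERIV_cmult DERIV_chain2[OF has_real_derivative_powr d\<rho>'[OF r]] pr)
      then show "(pressure \<gamma> \<rho> (\<lambda>_. A0) has_real_derivative csq (\<rho> r) * sl r) (at r within ?I)"
        by (simp add: pressure_def[abs_def] csq_def mult_ac)
    qed
    have 4: "ddr r0 r1 (\<lambda>r. swirl / r) r = - swirl / r\<^sup>2"
      by (rule ddrI[OF r])
        (use pr in \<open>auto intro!: derivative_eq_intros simp: power2_eq_square\<close>)
    have 5: "ddr r0 r1 (\<lambda>_. A0) r = 0"
      by (rule ddrI[OF r]) auto
    have 6: "ddr r0 r1 (\<lambda>r. w r / r) r = (r * (\<rho> r - b0) * r - w r) / r\<^sup>2"
      by (rule ddrI[OF r])
        (use pr in \<open>auto intro!: derivative_eq_intros dw[OF r] simp: power2_eq_square\<close>)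
    \<comment> \<open>Clearing the denominator in \<open>slope\<close> gives back the momentum
      balance.\<close>
    have "sl r * gap r (\<rho> r) = \<rho> r * (w r / r + (usq r (\<rho> r) + (swirl / r)\<^sup>2) / r)"
      using pr by (simp add: slope_def flip: sl_eq)
    then have "gap r (\<rho> r) * (sl r / \<rho> r) = w r / r + (usq r (\<rho> r) + (swirl / r)\<^sup>2) / r"
      using pr by (simp add: field_simps)
    then have key: "csq (\<rho> r) * (sl r / \<rho> r) - usq r (\<rho> r) * (sl r / \<rho> r)
        = w r / r + usq r (\<rho> r) / r + (swirl / r)\<^sup>2 / r"
      by (simp add: gap_def left_diff_distrib add_divide_distrib diff_divide_distrib)
    have alg: "v * (- v * (1 / r + t)) = - (v\<^sup>2 / r) - v\<^sup>2 * t" for v t :: real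
      by (simp add: power2_eq_square algebra_simps)
    have "flux / (r * \<rho> r) * (- flux / (r * \<rho> r) * (1 / r + sl r / \<rho> r))
        = - (usq r (\<rho> r) / r) - usq r (\<rho> r) * (sl r / \<rho> r)"
      using alg[of "flux / (r * \<rho> r)" "sl r / \<rho> r"] by (simp add: usq_def)
    moreover have "1 / \<rho> r * (csq (\<rho> r) * sl r) = csq (\<rho> r) * (sl r / \<rho> r)"
      by simp
    ultimately have m: "flux / (r * \<rho> r) * (- flux / (r * \<rho> r) * (1 / r + sl r / \<rho> r))
        + 1 / \<rho> r * (csq (\<rho> r) * sl r) - 1 / r * (swirl / r)\<^sup>2 = w r / r"
      using key by simp
    show ?thesis
      unfolding 1 2 3 4 5 6 m using pr by (simp add: field_simps power2_eq_square)
  qed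
  show ?thesis
    unfolding smooth_flow_def using smooth_all eqs by blast
qed

text \<open>The density derivative can be solved for only where \<open>gap\<close> is positive,
  which a flow does not promise. But wherever density and \<open>w\<close> are at least their
  initial values, the gap and both derivatives are positive;
  \<open>stay_above_initial_values\<close> turns this conditional statement into one on the whole
  interval.\<close>

lemma sol_of_smooth_flow:
  assumes fl: "smooth_flow \<gamma> b0 r0 r1 \<rho> U1 U2 A E" and r1: "r1 > r0"
    and init: "\<rho> r0 = \<rho>0" "U1 r0 = U10" "U2 r0 = U20" "A r0 = A0" "E r0 = E0"
  shows "sol r1 \<rho> (\<lambda>r. r * E r)"
    and "r \<in> {r0..r1} \<Longrightarrow> U1 r = flux / (r * \<rho> r) \<and> U2 r = swirl / r \<and> A r = A0"
proof -
  let ?I = "{r0..r1}"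
  have ddr_smooth: "(f has_real_derivative ddr r0 r1 f r) (at r within ?I)"
    if f: "smooth_on_Icc r0 r1 f" and r: "r \<in> ?I" for f r
  proof -
    obtain D where D: "(f has_real_derivative D) (at r within ?I)"
      using f r unfolding smooth_on_Icc_def by metis
    with ddr_eqI[OF r1 r D] show ?thesis by simp
  qed
  have sm: "smooth_on_Icc r0 r1 \<rho>" "smooth_on_Icc r0 r1 U1" "smooth_on_Icc r0 r1 U2"
    "smooth_on_Icc r0 r1 A" "smooth_on_Icc r0 r1 E"
    using fl by (auto simp: smooth_flow_def)
  note d = sm[THEN ddr_smooth]
  have pos: "r > 0" "\<rho> r > 0" if "r \<in> ?I" for r
    using that fl r0 by (auto simp: smooth_flow_def)
  have mass: "ddr r0 r1 (\<lambda>s. s * \<rho> s * U1 s) r = 0"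
    and mom: "U1 r * ddr r0 r1 U1 r + 1 / \<rho> r * ddr r0 r1 (pressure \<gamma> \<rho> A) r - 1 / r * (U2 r)\<^sup>2 = E r"
    and ang: "U1 r * ddr r0 r1 U2 r + 1 / r * U1 r * U2 r = 0"
    and ent: "U1 r * ddr r0 r1 A r = 0"
    and poi: "ddr r0 r1 E r + 1 / r * E r = \<rho> r - b0"
    if "r \<in> ?I" for r
    using fl that by (auto simp: smooth_flow_def)
  have dmass': "((\<lambda>s. s * \<rho> s * U1 s) has_real_derivative
      (\<rho> r + r * ddr r0 r1 \<rho> r) * U1 r + r * \<rho> r * ddr r0 r1 U1 r) (at r within ?I)"
    if "r \<in> ?I" for r
    by (auto intro!: derivative_eq_intros d that)
  have mass': "(\<rho> r + r * ddr r0 r1 \<rho> r) * U1 r + r * \<rho> r * ddr r0 r1 U1 r = 0" if "r \<in> ?I" for r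
    using ddr_eqI[OF r1 that dmass'[OF that]] mass[OF that] by simp
  have dmass: "((\<lambda>s. s * \<rho> s * U1 s) has_real_derivative 0) (at r within ?I)" if "r \<in> ?I" for r
    using dmass'[OF that] mass'[OF that] by simp
  have U1: "U1 r = flux / (r * \<rho> r)" if "r \<in> ?I" for r
    using constant_of_zero_derivative_within[OF dmass that] pos[OF that]
    by (simp add: init flux_def field_simps)
  \<comment> \<open>Positivity of the radial speed allows cancelling \<open>U1\<close> in the
    entropy and angular momentum equations.\<close>
  have U1_pos: "U1 r > 0" if "r \<in> ?I" for r
    using U1[OF that] flux_pos pos[OF that] by simp
  have A: "A r = A0" if "r \<in> ?I" for r
  proof -
    have "(A has_real_derivative 0) (at r within ?I)" if "r \<in> ?I" for r
      using d(4)[OF that] ent[OF that] U1_pos[OF that] by simp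
    from constant_of_zero_derivative_within[OF this that] show ?thesis by (simp add: init)
  qed
  have U2: "U2 r = swirl / r" if "r \<in> ?I" for r
  proof -
    have "((\<lambda>r. r * U2 r) has_real_derivative 0) (at r within ?I)" if r: "r \<in> ?I" for r
    proof -
      have "U1 r * (ddr r0 r1 U2 r + U2 r / r) = 0"
        using ang[OF r] by (simp add: algebra_simps)
      then have "ddr r0 r1 U2 r + U2 r / r = 0"
        using U1_pos[OF r] by simp
      then have "U2 r + r * ddr r0 r1 U2 r = 0"
        using pos[OF r] by (simp add: field_simps)
      then show ?thesis
        by (auto intro!: derivative_eq_intros d r simp: mult.commute)
    qed
    from constant_of_zero_derivative_within[OF this that] show ?thesis
      using pos[OF that] by (simp add: init swirl_def field_simps)
  qed
  show "r \<in> ?I \<Longrightarrow> U1 r = flux / (r * \<rho> r) \<and> U2 r = swirl / r \<and> A r = A0"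
    using U1 U2 A by blast
  define w where "w r = r * E r" for r
  have dw: "(w has_real_derivative r * (\<rho> r - b0)) (at r within ?I)" if r: "r \<in> ?I" for r
  proof -
    have "E r + r * ddr r0 r1 E r = r * (\<rho> r - b0)"
      using poi[OF r] pos[OF r] by (simp add: field_simps)
    then show ?thesis
      unfolding w_def by (auto intro!: derivative_eq_intros d r simp: mult.commute)
  qed
  have d\<rho>: "ddr r0 r1 \<rho> r = slope r (\<rho> r) (w r)" if r: "r \<in> ?I" and gap: "gap r (\<rho> r) > 0" for r
  proof -
    let ?\<rho>' = "ddr r0 r1 \<rho> r"
    note pr = pos[OF r]
    have U1': "ddr r0 r1 U1 r = - U1 r * (1 / r + ?\<rho>' / \<rho> r)"
      using mass'[OF r] pr by (simp add: field_simps)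
    have P': "ddr r0 r1 (pressure \<gamma> \<rho> A) r = csq (\<rho> r) * ?\<rho>'"
    proof -
      have P: "((\<lambda>s. A0 * \<rho> s powr \<gamma>) has_real_derivative A0 * (\<gamma> * \<rho> r powr (\<gamma> - 1) * ?\<rho>')) (at r within ?I)"
        by (intro DERIV_cmult DERIV_chain2[OF has_real_derivative_powr d(1)[OF r]] pr)
      have "(pressure \<gamma> \<rho> A has_real_derivative csq (\<rho> r) * ?\<rho>') (at r within ?I)"
        using has_real_derivative_transform[OF r _ P, of "pressure \<gamma> \<rho> A"]
        by (simp add: pressure_def A csq_def mult_ac)
      then show ?thesis by (rule ddr_eqI[OF r1 r])
    qed
    have "(U1 r)\<^sup>2 = usq r (\<rho> r)" using U1[OF r] by (simp add: usq_def)
    moreover have "U1 r * (- U1 r * (1 / r + ?\<rho>' / \<rho> r)) + 1 / \<rho> r * (csq (\<rho> r) * ?\<rho>') - 1 / r * (U2 r)\<^sup>2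
        = (csq (\<rho> r) - (U1 r)\<^sup>2) * (?\<rho>' / \<rho> r) - ((U1 r)\<^sup>2 + (U2 r)\<^sup>2) / r"
      by (simp add: algebra_simps power2_eq_square add_divide_distrib)
    ultimately have "gap r (\<rho> r) * (?\<rho>' / \<rho> r) = E r + (usq r (\<rho> r) + (swirl / r)\<^sup>2) / r"
      using mom[OF r] U2[OF r] unfolding U1' P' gap_def by simp
    also have "E r = w r / r" using pr by (simp add: w_def)
    finally show ?thesis
      using pr gap by (simp add: slope_def field_simps)
  qed
  have above: "\<rho> r \<ge> \<rho> r0 \<and> w r \<ge> w r0" if "r \<in> ?I" for r
  proof (rule stay_above_initial_values[OF d(1) dw _ that])
    fix r assume r: "r \<in> ?I" and ge: "\<rho> r \<ge> \<rho> r0" "w r \<ge> w r0"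
    have "gap r (\<rho> r) > 0" "slope r (\<rho> r) (w r) > 0"
      using r ge gap_pos slope_pos by (auto simp: init w_def)
    then show "ddr r0 r1 \<rho> r > 0 \<and> r * (\<rho> r - b0) > 0"
      using d\<rho>[OF r] pos[OF r] ge \<rho>0_gt by (auto simp: init)
  qed
  have "(\<rho> has_real_derivative slope r (\<rho> r) (w r)) (at r within ?I)" if r: "r \<in> ?I" for r
    using d(1)[OF r] d\<rho>[OF r] gap_pos[of r "\<rho> r"] above[OF r] r by (auto simp: init)
  then have "sol r1 \<rho> w"
    unfolding sol_def using above dw by (auto simp: init w_def)
  then show "sol r1 \<rho> (\<lambda>r. r * E r)"
    by (simp add: w_def[abs_def])
qed

section \<open>The sonic transition and the lifespan\<close>

text \<open>Target radius and target density are chosen so that attaining either one makes the flow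
  subsonic; it is left open which comes first.\<close>

lemma sol_reaches_subsonic:
  obtains R \<rho> w where "R > r0" "sol R \<rho> w" "usq R (\<rho> R) + (swirl / R)\<^sup>2 < csq (\<rho> R)"
proof -
  define s where "s = U10\<^sup>2 + U20\<^sup>2"
  have c0: "csq \<rho>0 > 0" and s: "s > 0"
    using csq_pos \<rho>0 U10 by (auto simp: s_def add_pos_nonneg)
  \<comment> \<open>Chosen so that \<open>csq\<close> at \<open>B powr (1 / (\<gamma> - 1))\<close>
    equals \<open>\<gamma> * A0 * B = s + \<gamma> * A0\<close>, which exceeds the initial squared
    speed \<open>s\<close>.\<close>
  define B where "B = s / (\<gamma> * A0) + 1"
  have B: "B > 0" using s \<gamma> A0 by (simp add: B_def add_pos_pos)
  define N where "N = max (\<rho>0 + 1) (B powr (1 / (\<gamma> - 1)))"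
  have N_gt: "N > \<rho>0" by (simp add: N_def)
  \<comment> \<open>At this radius \<open>r0 / L = csq \<rho>0 / (csq \<rho>0 + s)\<close>, hence
    \<open>s * (r0 / L) < csq \<rho>0\<close>.\<close>
  define L where "L = r0 * ((csq \<rho>0 + s) / csq \<rho>0)"
  have "s < csq (B powr (1 / (\<gamma> - 1)))"
    using B \<gamma> A0 by (simp add: csq_def powr_powr) (simp add: B_def field_simps)
  also have "\<dots> \<le> csq N"
    using B by (intro csq_mono) (auto simp: N_def)
  finally have cN: "s < csq N" .
  have L: "L > r0"
    using r0 c0 s by (simp add: L_def field_simps)
  obtain R \<rho> w where R: "r0 < R" "sol R \<rho> w" "R = L \<or> \<rho> R = N"
    using sol_until_density[OF _ L, of N] N_gt by metis
  have \<rho>R: "\<rho> R \<ge> \<rho>0" using R by (auto simp: sol_def)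
  define t where "t = r0 / R"
  have t: "0 < t" "t < 1" using R(1) r0 by (auto simp: t_def)
  have "usq R (\<rho> R) + (swirl / R)\<^sup>2 \<le> U10\<^sup>2 * t\<^sup>2 + U20\<^sup>2 * t\<^sup>2"
    using usq_le(1)[of R "\<rho> R"] R(1) \<rho>R
    by (simp add: t_def swirl_def power_mult_distrib power_divide mult.commute)
  also have "\<dots> = s * t\<^sup>2" by (simp add: s_def algebra_simps)
  \<comment> \<open>Giving up one power of \<open>t\<close> keeps the condition on \<open>L\<close>
    rational, without a square root.\<close>
  also have "\<dots> \<le> s * t"
    using t s by (intro mult_left_mono) (auto simp: power2_eq_square mult_left_le)
  finally have le: "usq R (\<rho> R) + (swirl / R)\<^sup>2 \<le> s * t" .
  from R(3) have "s * t < csq (\<rho> R)"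
  proof
    assume "R = L"
    then have "t = csq \<rho>0 / (csq \<rho>0 + s)"
      using r0 by (simp add: t_def L_def)
    then have "s * t < csq \<rho>0"
      using c0 s mult_pos_pos[OF t(1) c0] by (simp add: field_simps)
    also have "\<dots> \<le> csq (\<rho> R)" using csq_mono \<rho>0 \<rho>R by simp
    finally show ?thesis .
  next
    assume "\<rho> R = N"
    have "s * t \<le> s * 1" using t s by (intro mult_left_mono) auto
    with cN \<open>\<rho> R = N\<close> show ?thesis by simp
  qed
  with le R that show thesis by force
qed

text \<open>For \<open>\<gamma> \<ge> 2\<close> the density is bounded linearly by the squared sound speed, so that the latter and
  \<open>w\<close> satisfy linear differential inequalities.\<close>
lemma sol_bounded:
  assumes \<gamma>2: "\<gamma> \<ge> 2" and L: "L > r0"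
  obtains C where "\<And>r \<rho> w. r0 \<le> r \<Longrightarrow> r \<le> L \<Longrightarrow> sol r \<rho> w \<Longrightarrow> \<rho> r \<le> C"
proof -
  define c0 where "c0 = csq \<rho>0"
  have c0: "c0 > U10\<^sup>2" using radially_subsonic by (simp add: c0_def csq_def)
  \<comment> \<open>The quotient \<open>c^2 / (c^2 - U10^2)\<close> decreases in \<open>c^2\<close>,
    so its value at the initial sound speed bounds \<open>csq / gap\<close> throughout.\<close>
  define k where "k = c0 / (c0 - U10\<^sup>2)"
  have "c0 > 0" using c0 by (meson le_less_trans zero_le_power2)
  then have k: "k > 0" using c0 by (simp add: k_def)
  define s where "s = U10\<^sup>2 + U20\<^sup>2"
  have s: "s \<ge> 0" by (simp add: s_def)
  \<comment> \<open>In \<open>x = x powr (\<gamma> - 1) * x powr (2 - \<gamma>)\<close> the last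
    exponent is nonpositive, so that factor is largest at \<open>\<rho>0\<close>. This is where
    \<open>\<gamma> \<ge> 2\<close> enters.\<close>
  define q where "q = \<rho>0 powr (2 - \<gamma>) / (\<gamma> * A0)"
  have q: "q > 0" using \<rho>0 \<gamma> A0 by (simp add: q_def)
  have x_le: "x \<le> q * csq x" if "x \<ge> \<rho>0" for x
  proof -
    have "x = x powr (\<gamma> - 1) * x powr (2 - \<gamma>)"
      using that \<rho>0 by (simp flip: powr_add)
    also have "\<dots> \<le> x powr (\<gamma> - 1) * \<rho>0 powr (2 - \<gamma>)"
      using that \<rho>0 \<gamma>2 by (intro mult_left_mono powr_mono2') auto
    also have "\<dots> = q * csq x"
      using \<gamma> A0 by (simp add: q_def csq_def)
    finally show ?thesis .
  qed
  have csq_le: "csq x \<le> k * gap r x" if "r \<ge> r0" "x \<ge> \<rho>0" for r x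
  proof -
    have "c0 \<le> csq x" using that \<rho>0 by (simp add: c0_def csq_mono)
    then have "U10\<^sup>2 * c0 \<le> U10\<^sup>2 * csq x" by (intro mult_left_mono) auto
    then have "csq x \<le> k * (csq x - U10\<^sup>2)"
      using c0 by (simp add: k_def field_simps)
    also have "\<dots> \<le> k * gap r x"
      using usq_le(2)[OF that] k by (intro mult_left_mono) (auto simp: gap_def)
    finally show ?thesis .
  qed
  define a where "a = (\<gamma> - 1) * k / r0"
  have a: "a > 0" using \<gamma> k r0 by (simp add: a_def)
  \<comment> \<open>The derivative of \<open>csq\<close> is at most \<open>a * (w + s)\<close> and
    that of \<open>w\<close> at most \<open>L * q * csq\<close>; \<open>K\<close> dominates both
    against \<open>csq + w + 1\<close>.\<close>
  define K where "K = a * (1 + s) + L * q"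
  define C where "C = q * ((c0 + r0 * E0 + 1) * exp (K * (L - r0)))"
  have "\<rho> r \<le> C" if r: "r0 \<le> r" "r \<le> L" and sl: "sol r \<rho> w" for r \<rho> w
  proof -
    have \<rho>_ge: "\<rho> x \<ge> \<rho>0" and w_ge: "w x \<ge> 0"
      and d\<rho>: "(\<rho> has_real_derivative slope x (\<rho> x) (w x)) (at x within {r0..r})"
      and dw: "(w has_real_derivative x * (\<rho> x - b0)) (at x within {r0..r})"
      if "x \<in> {r0..r}" for x
    proof -
      have *: "\<rho> x \<ge> \<rho>0 \<and> w x \<ge> r0 * E0 \<and>
          (\<rho> has_real_derivative slope x (\<rho> x) (w x)) (at x within {r0..r}) \<and>
          (w has_real_derivative x * (\<rho> x - b0)) (at x within {r0..r})"
        using sl that unfolding sol_def by blast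
      moreover have "r0 * E0 > 0" using r0 E0 by simp
      ultimately show "\<rho> x \<ge> \<rho>0" "w x \<ge> 0"
        "(\<rho> has_real_derivative slope x (\<rho> x) (w x)) (at x within {r0..r})"
        "(w has_real_derivative x * (\<rho> x - b0)) (at x within {r0..r})"
        by (blast | linarith)+
    qed
    \<comment> \<open>The summand 1 absorbs the constant \<open>a * s\<close>, so that an affine
      inequality becomes the linear one required by Gronwall.\<close>
    define S where "S x = csq (\<rho> x) + w x + 1" for x
    define S' where "S' x = (\<gamma> - 1) * csq (\<rho> x) / \<rho> x * slope x (\<rho> x) (w x) + x * (\<rho> x - b0)" for x
    have dS: "(S has_real_derivative S' x) (at x within {r0..r})" if x: "x \<in> {r0..r}" for x
    proof -
      have pos: "\<rho> x > 0" using \<rho>_ge[OF x] \<rho>0 by simp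
      have "((\<lambda>x. csq (\<rho> x)) has_real_derivative
          \<gamma> * A0 * ((\<gamma> - 1) * \<rho> x powr (\<gamma> - 1 - 1) * slope x (\<rho> x) (w x))) (at x within {r0..r})"
        unfolding csq_def by (intro DERIV_cmult DERIV_chain2[OF has_real_derivative_powr d\<rho>[OF x]] pos)
      moreover have "\<rho> x powr (\<gamma> - 1 - 1) = \<rho> x powr (\<gamma> - 1) / \<rho> x"
        using pos by (subst powr_diff) auto
      ultimately have "((\<lambda>x. csq (\<rho> x)) has_real_derivative
          (\<gamma> - 1) * csq (\<rho> x) / \<rho> x * slope x (\<rho> x) (w x)) (at x within {r0..r})"
        by (simp add: csq_def mult_ac)
      then show ?thesis
        unfolding S_def S'_def by (auto intro!: derivative_eq_intros dw[OF x])
    qed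
    have S'_le: "S' x \<le> K * S x" if x: "x \<in> {r0..r}" for x
    proof -
      have xr: "x \<ge> r0" "x > 0" "x \<le> L" using x r r0 by auto
      note g = \<rho>_ge[OF x] w_ge[OF x] gap_pos[OF xr(1) \<rho>_ge[OF x]]
      have pos: "\<rho> x > 0" using g \<rho>0 by simp
      have csq: "csq (\<rho> x) > 0" using csq_pos pos by simp
      have "(swirl / x)\<^sup>2 \<le> U20\<^sup>2"
      proof -
        have "(swirl / x)\<^sup>2 = U20\<^sup>2 * (r0 / x)\<^sup>2"
          by (simp add: swirl_def power_mult_distrib power_divide)
        also have "\<dots> \<le> U20\<^sup>2 * 1"
          using xr r0 by (intro mult_left_mono power_le_one) auto
        finally show ?thesis by simp
      qed
      then have "usq x (\<rho> x) + (swirl / x)\<^sup>2 \<le> s"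
        using usq_le(2)[OF xr(1) g(1)] by (simp add: s_def)
      then have "w x / x + (usq x (\<rho> x) + (swirl / x)\<^sup>2) / x \<le> (w x + s) / r0"
        unfolding add_divide_distrib[symmetric]
        using xr r0 g(2) s by (intro frac_le) auto
      moreover have "0 \<le> w x / x + (usq x (\<rho> x) + (swirl / x)\<^sup>2) / x"
        using g(2) xr by (auto simp: usq_def intro!: add_nonneg_nonneg divide_nonneg_pos)
      moreover have "csq (\<rho> x) / gap x (\<rho> x) \<le> k"
        using csq_le[OF xr(1) g(1)] g(3) by (simp add: pos_divide_le_eq)
      ultimately have "csq (\<rho> x) / gap x (\<rho> x) * (w x / x + (usq x (\<rho> x) + (swirl / x)\<^sup>2) / x)
          \<le> k * ((w x + s) / r0)"
        using k by (intro mult_mono) auto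
      then have "(\<gamma> - 1) * (csq (\<rho> x) / gap x (\<rho> x) * (w x / x + (usq x (\<rho> x) + (swirl / x)\<^sup>2) / x))
          \<le> (\<gamma> - 1) * (k * ((w x + s) / r0))"
        using \<gamma> by (intro mult_left_mono) auto
      moreover have "(\<gamma> - 1) * csq (\<rho> x) / \<rho> x * slope x (\<rho> x) (w x)
          = (\<gamma> - 1) * (csq (\<rho> x) / gap x (\<rho> x) * (w x / x + (usq x (\<rho> x) + (swirl / x)\<^sup>2) / x))"
        using pos by (simp add: slope_def)
      ultimately have 1: "(\<gamma> - 1) * csq (\<rho> x) / \<rho> x * slope x (\<rho> x) (w x) \<le> a * (w x + s)"
        by (simp add: a_def)
      have "x * (\<rho> x - b0) \<le> L * (q * csq (\<rho> x))"
        using xr r0 b0 x_le[OF g(1)] g(1) \<rho>0_gt by (intro mult_mono) auto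
      with 1 have "S' x \<le> a * (w x + s) + L * q * csq (\<rho> x)"
        by (simp add: S'_def)
      also have "\<dots> \<le> K * S x"
      proof -
        have "K * S x - (a * (w x + s) + L * q * csq (\<rho> x))
            = a * (1 + s) * csq (\<rho> x) + a * s * w x + a + L * q * (w x + 1)"
          by (simp add: K_def S_def algebra_simps)
        moreover have "\<dots> \<ge> 0"
          using a s csq g(2) L r0 q by (intro add_nonneg_nonneg mult_nonneg_nonneg) auto
        ultimately show ?thesis by simp
      qed
      finally show ?thesis .
    qed
    have r_in: "r \<in> {r0..r}" using r by simp
    have K: "K \<ge> 0"
      unfolding K_def using a s L r0 q by (intro add_nonneg_nonneg mult_nonneg_nonneg) auto
    have "csq (\<rho> r) \<le> S r"
      using w_ge[OF r_in] by (simp add: S_def)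
    also have "S r \<le> S r0 * exp (K * (r - r0))"
      by (rule gronwall_exp[OF dS S'_le r_in])
    also have "S r0 = c0 + r0 * E0 + 1"
      using sl by (simp add: S_def sol_def c0_def)
    also have "(c0 + r0 * E0 + 1) * exp (K * (r - r0)) \<le> (c0 + r0 * E0 + 1) * exp (K * (L - r0))"
      using r K \<open>c0 > 0\<close> mult_pos_pos[OF r0 E0] by (intro mult_left_mono) (auto intro: mult_left_mono)
    finally have "q * csq (\<rho> r) \<le> C"
      unfolding C_def using q by (intro mult_left_mono) auto
    then show ?thesis
      using x_le[OF \<rho>_ge[OF r_in]] by simp
  qed
  then show thesis using that by blast
qed

text \<open>A target density above the a priori bound is never attained, so the solution must arrive
  at \<open>L\<close>.\<close>

lemma sol_global:
  assumes "\<gamma> \<ge> 2" and L: "L > r0"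
  shows "\<exists>\<rho> w. sol L \<rho> w"
proof -
  obtain C where C: "\<And>r \<rho> w. r0 \<le> r \<Longrightarrow> r \<le> L \<Longrightarrow> sol r \<rho> w \<Longrightarrow> \<rho> r \<le> C"
    using sol_bounded[OF assms] by metis
  have N: "max (\<rho>0 + 1) (C + 1) > \<rho>0" by simp
  obtain r \<rho> w where r: "r0 < r" "r \<le> L" "sol r \<rho> w" "r = L \<or> \<rho> r = max (\<rho>0 + 1) (C + 1)"
    using sol_until_density[OF N L] by metis
  have "\<rho> r \<le> C" using C r by simp
  then have "r = L" using r(4) by linarith
  with r(3) show ?thesis by blast
qed

end

text \<open>\<open>R\<close> is a threshold for the sonic transition and \<open>T\<close> the end of
  the lifespan. The last clause makes \<open>T\<close> sharp: from \<open>T\<close> on there is no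
  smooth flow at all with these data, transonic or not. For \<open>\<gamma> \<ge> 2\<close> every
  \<open>r1 > R\<close> is covered.\<close>

theorem proposition1p2:
  fixes \<gamma> r0 b0 \<rho>0 U10 U20 A0 E0 :: real
  assumes "\<gamma> > 1" and "r0 > 0" and "b0 > 0"
    and "\<rho>0 > 0" and "U10 > 0" and "A0 > 0" and "E0 > 0"
    and "\<rho>0 > b0"
    and "U10\<^sup>2 < \<gamma> * A0 * \<rho>0 powr (\<gamma> - 1)"
    and "\<gamma> * A0 * \<rho>0 powr (\<gamma> - 1) < U10\<^sup>2 + U20\<^sup>2"
  shows "\<exists>R > r0. \<exists>T :: ereal. ereal R < T \<and> (\<gamma> \<ge> 2 \<longrightarrow> T = \<infinity>) \<and>
    (\<forall>r1 > R. ereal r1 < T \<longrightarrow>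
      (\<exists>\<rho> U1 U2 A E.
        (smooth_transonic_flow \<gamma> b0 r0 r1 \<rho> U1 U2 A E \<and>
          \<rho> r0 = \<rho>0 \<and> U1 r0 = U10 \<and> U2 r0 = U20 \<and> A r0 = A0 \<and> E r0 = E0) \<and>
        (\<forall>\<rho>' U1' U2' A' E'.
          smooth_transonic_flow \<gamma> b0 r0 r1 \<rho>' U1' U2' A' E' \<and>
          \<rho>' r0 = \<rho>0 \<and> U1' r0 = U10 \<and> U2' r0 = U20 \<and> A' r0 = A0 \<and> E' r0 = E0 \<longrightarrow>
          (\<forall>r\<in>{r0..r1}. \<rho>' r = \<rho> r \<and> U1' r = U1 r \<and> U2' r = U2 r \<and> A' r = A r \<and> E' r = E r)))) \<and>
    (\<forall>r1 > R. T \<le> ereal r1 \<longrightarrow>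
      \<not> (\<exists>\<rho> U1 U2 A E. smooth_flow \<gamma> b0 r0 r1 \<rho> U1 U2 A E \<and>
            \<rho> r0 = \<rho>0 \<and> U1 r0 = U10 \<and> U2 r0 = U20 \<and> A r0 = A0 \<and> E r0 = E0))"
proof -
  interpret euler_poisson_data \<gamma> r0 b0 \<rho>0 U10 U20 A0 E0
    using assms by unfold_locales
  define X where "X = {r. r > r0 \<and> (\<exists>\<rho> w. sol r \<rho> w)}"
  \<comment> \<open>Every member of \<open>X\<close> can be exceeded and \<open>X\<close> is closed
    downwards above \<open>r0\<close>, so \<open>X\<close> is exactly the open interval from
    \<open>r0\<close> to \<open>T\<close>.\<close>
  define T where "T = (SUP r\<in>X. ereal r)"
  have below: "ereal r < T" if "r \<in> X" for r
  proof -
    obtain \<rho> w where "sol r \<rho> w" and r: "r > r0" using \<open>r \<in> X\<close> by (auto simp: X_def)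
    then obtain r2 \<rho>' w' where "r2 > r" "sol r2 \<rho>' w'"
      using sol_extend[of r \<rho> w] by (metis less_imp_le)
    moreover from this have "r2 \<in> X" using r by (auto simp: X_def)
    ultimately show ?thesis
      unfolding T_def less_SUP_iff by (intro bexI[of _ r2]) auto
  qed
  have in_X: "r \<in> X" if r: "r > r0" "ereal r < T" for r
  proof -
    obtain r2 \<rho> w where "r < r2" "sol r2 \<rho> w"
      using r(2) unfolding T_def less_SUP_iff X_def by auto
    then show ?thesis
      using r(1) sol_subset[of r2 \<rho> w r] unfolding X_def by auto
  qed
  obtain R \<rho>R wR where R: "R > r0" "sol R \<rho>R wR" "usq R (\<rho>R R) + (swirl / R)\<^sup>2 < csq (\<rho>R R)"
    using sol_reaches_subsonic .
  then have "R \<in> X" by (auto simp: X_def)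
  have infinite: "T = \<infinity>" if "\<gamma> \<ge> 2"
  proof (rule ereal_top)
    fix B
    have "max B (r0 + 1) \<in> X"
      using sol_global[OF that, of "max B (r0 + 1)"] by (auto simp: X_def)
    then have "ereal (max B (r0 + 1)) \<le> T" by (rule less_imp_le[OF below])
    moreover have "ereal B \<le> ereal (max B (r0 + 1))" unfolding ereal_less_eq by simp
    ultimately show "ereal B \<le> T" by (rule order_trans[rotated])
  qed
  have exists_unique: "\<exists>\<rho> U1 U2 A E.
      (smooth_transonic_flow \<gamma> b0 r0 r1 \<rho> U1 U2 A E \<and>
        \<rho> r0 = \<rho>0 \<and> U1 r0 = U10 \<and> U2 r0 = U20 \<and> A r0 = A0 \<and> E r0 = E0) \<and>
      (\<forall>\<rho>' U1' U2' A' E'.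
        smooth_transonic_flow \<gamma> b0 r0 r1 \<rho>' U1' U2' A' E' \<and>
        \<rho>' r0 = \<rho>0 \<and> U1' r0 = U10 \<and> U2' r0 = U20 \<and> A' r0 = A0 \<and> E' r0 = E0 \<longrightarrow>
        (\<forall>r\<in>{r0..r1}. \<rho>' r = \<rho> r \<and> U1' r = U1 r \<and> U2' r = U2 r \<and> A' r = A r \<and> E' r = E r))"
    if r1: "r1 > R" "ereal r1 < T" for r1
  proof -
    have r1_gt: "r1 > r0" using r1 R by simp
    obtain \<rho> w where sl: "sol r1 \<rho> w"
      using in_X[OF r1_gt r1(2)] by (auto simp: X_def)
    let ?U1 = "\<lambda>r. flux / (r * \<rho> r)" and ?U2 = "\<lambda>r. swirl / r"
    have init: "\<rho> r0 = \<rho>0" "?U1 r0 = U10" "?U2 r0 = U20" "w r0 / r0 = E0"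
      using sl r0 \<rho>0 by (auto simp: sol_def flux_def swirl_def)
    \<comment> \<open>The supersonic point is \<open>r0\<close>, by the incoming data; the subsonic
      point is \<open>R\<close>, where by uniqueness the density agrees with that of the solution
      used to find \<open>R\<close>.\<close>
    have "mach_sq \<gamma> \<rho> ?U1 ?U2 (\<lambda>_. A0) r0 > 1"
      using supersonic csq_pos[OF \<rho>0] init(2,3)
      by (simp only: mach_sq_def init(1) sound_speed_sq_def csq_def less_divide_eq_1_pos)
    moreover have "mach_sq \<gamma> \<rho> ?U1 ?U2 (\<lambda>_. A0) R < 1"
    proof -
      have "\<rho> R = \<rho>R R"
        using sol_unique[OF R(2) sol_subset[OF sl], of R] r1 R(1) by auto
      moreover have "csq (\<rho> R) > 0"
        using sl r1 R(1) \<rho>0 by (intro csq_pos) (auto simp: sol_def dest!: bspec[of _ _ R])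
      ultimately show ?thesis
        using R(3) by (simp add: mach_sq_def sound_speed_sq_def usq_def csq_def)
    qed
    ultimately have flow: "smooth_transonic_flow \<gamma> b0 r0 r1 \<rho> ?U1 ?U2 (\<lambda>_. A0) (\<lambda>r. w r / r)"
      unfolding smooth_transonic_flow_def
      using smooth_flow_of_sol[OF sl r1_gt] r1 R(1)
      by (intro conjI bexI[of _ r0] bexI[of _ R]) auto
    have "\<rho>' r = \<rho> r \<and> U1' r = ?U1 r \<and> U2' r = ?U2 r \<and> A' r = A0 \<and> E' r = w r / r"
      if fl: "smooth_transonic_flow \<gamma> b0 r0 r1 \<rho>' U1' U2' A' E'"
        and i: "\<rho>' r0 = \<rho>0" "U1' r0 = U10" "U2' r0 = U20" "A' r0 = A0" "E' r0 = E0"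
        and r: "r \<in> {r0..r1}" for \<rho>' U1' U2' A' E' r
    proof -
      have fl': "smooth_flow \<gamma> b0 r0 r1 \<rho>' U1' U2' A' E'"
        using fl by (simp add: smooth_transonic_flow_def)
      have "\<rho>' r = \<rho> r \<and> r * E' r = w r"
        using sol_unique[OF sl sol_of_smooth_flow(1)[OF fl' r1_gt i] r] .
      moreover from this have "E' r = w r / r"
        using r r0 by (auto simp: field_simps)
      ultimately show ?thesis
        using sol_of_smooth_flow(2)[OF fl' r1_gt i r] by simp
    qed
    with flow init show ?thesis
      by (intro exI[of _ \<rho>] exI[of _ ?U1] exI[of _ ?U2] exI[of _ "\<lambda>_. A0"] exI[of _ "\<lambda>r. w r / r"])
        blast
  qed
  have no_flow: "\<not> (\<exists>\<rho> U1 U2 A E. smooth_flow \<gamma> b0 r0 r1 \<rho> U1 U2 A E \<and>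
      \<rho> r0 = \<rho>0 \<and> U1 r0 = U10 \<and> U2 r0 = U20 \<and> A r0 = A0 \<and> E r0 = E0)"
    if r1: "r1 > R" "T \<le> ereal r1" for r1
  proof
    have r1_gt: "r1 > r0" using r1 R by simp
    assume "\<exists>\<rho> U1 U2 A E. smooth_flow \<gamma> b0 r0 r1 \<rho> U1 U2 A E \<and>
      \<rho> r0 = \<rho>0 \<and> U1 r0 = U10 \<and> U2 r0 = U20 \<and> A r0 = A0 \<and> E r0 = E0"
    then have "r1 \<in> X"
      using sol_of_smooth_flow(1)[OF _ r1_gt] r1_gt unfolding X_def by blast
    then show False using below[of r1] r1(2) by simp
  qed
  show ?thesis
    using R(1) below[OF \<open>R \<in> X\<close>] infinite exists_unique no_flow
    by (intro exI[of _ R] exI[of _ T] conjI) blast+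
qed

end
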